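(* Let $(X,\|\cdot\|)$ and $(V,\|\cdot\|_V)$ be real Banach spaces, $S\subseteq X$, with a symmetrization map $*$ and a polarization map indexed by $\mathcal H_*$ forming an abstract symmetrization framework (defined in the context). Let $m\ge 1$, let $\mathbb D$ and $\mathbb S$ be the closed unit ball and the unit sphere of $\mathbb R^m$. Let $\Lambda\subset\mathbb R$ be a compact interval, and let $f:\Lambda\times X\to\mathbb R$ be such that $f(\lambda;\cdot)$ is continuous for every $\lambda\in\Lambda$. Let $\Gamma_0\subset C(\mathbb S;X)$ and $$\Gamma:=\{\gamma\in C(\mathbb D,X):\gamma|_{\mathbb S}\in\Gamma_0\}\neq\emptyset,\quad c(\lambda):=\inf_{\gamma\in\Gamma}\sup_{t\in\mathbb D}f(\lambda;\gamma(t)),\quad a(\lambda):=\sup_{\gamma_0\in\Gamma_0}\sup_{\tau\in\mathbb S}f(\lambda;\gamma_0(\tau)).$$ Assume: (i) $c(\lambda)>a(\lambda)$ for all $\lambda\in\Lambda$. (ii) For every sequence $(\lambda_h,u_h)\subset\Lambda\times X$ with $(\lambda_h)$ strictly increasing and converging to $\lambda$, for which there exists $C\in\mathbb R$ with $$f(\lambda_h;u_h)\le C,\qquad -f(\lambda;u_h)\le C,\qquad \frac{f(\lambda_h;u_h)-f(\lambda;u_h)}{\lambda-\lambda_h}\le C\qquad\text{for all }h\ge1,$$ one has $\|u_h\|\le\mathcal M$ for some number $\mathcal M=\mathcal M(C)\ge0$ and all $h\ge1$, and, for every $\varepsilon>0$, $f(\lambda;u_h)\le f(\lambda_h;u_h)+\varepsilon$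 for all $h\ge1$ sufficiently large. (iii) For every $\gamma\in\Gamma$ there are $\hat\gamma\in\Gamma$ and $H_0\in\mathcal H_*$ such that $\hat\gamma(\mathbb D)\subset S$, the map $\tau\mapsto\hat\gamma(\tau)^{H_0}$ on $\mathbb S$ belongs to $\Gamma_0$, and $f(\lambda;\hat\gamma(t))\le f(\lambda;\gamma(t))$ for all $t\in\mathbb D$ and $\lambda\in\Lambda$. Moreover, $f(\lambda;u^H)\le f(\lambda;u)$ for all $\lambda\in\Lambda$, $H\in\mathcal H_*$ and $u\in S$. Then for almost every $\lambda\in\Lambda$ (with respect to Lebesgue measure) the following holds: if $f(\lambda;\cdot)$ satisfies the condition $(SBPS)_{c(\lambda)}$, then there exists $u_\lambda\in X$ with $|df(\lambda;\cdot)|(u_\lambda)=0$ (i.e. $u_\lambda$ is a critical point of $f(\lambda;\cdot)$), $f(\lambda;u_\lambda)=c(\lambda)$ and $u_\lambda=u_\lambda^*$.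
   Context: Abstract symmetrization framework: $X,V$ are Banach spaces, $S\subseteq X$, $\mathcal H_*$ is a path-connected topological space, and two maps are given: $*:S\to S$, $u\mapsto u^*$ (symmetrization), and $h:S\times\mathcal H_*\to S$, $(u,H)\mapsto u^H$ (polarization), such that: (1) $X$ is continuously embedded in $V$; (2) $h$ is continuous ($S$ with the topology induced by $X$); (3) for all $u\in S$, $H\in\mathcal H_*$: $(u^* )^H=(u^H)^*=u^*$ and $u^{HH}=u^H$; (4) there is a sequence $(H_m)\subset\mathcal H_*$ such that, for every $u\in S$, $u^{H_1\cdots H_m}:=(\cdots(u^{H_1})^{H_2}\cdots)^{H_m}$ converges to $u^*$ in $V$ as $m\to\infty$; (5) $\|u^H-v^H\|_V\le\|u-v\|_V$ for all $u,v\in S$, $H\in\mathcal H_*$. Moreover there is given a Lipschitz map $\Theta:(X,\|\cdot\|_V)\to(S,\|\cdot\|_V)$ with $\Theta|_S=\mathrm{Id}|_S$, and $*$ is extended to all of $X$ by $u^*:=(\Theta(u))^*$ for $u\in X$. (Consequently there is $C_\Theta>0$ with $\|u^*-v^*\|_V\le C_\Theta\|u-v\|_V$ for all $u,v\in X$.) Weak slope: for a metric space $(X,d)$, a continuous $g:X\to\mathbb R$ and $u\in X$, $|dg|(u)\in[0,+\infty]$ is the supremum of the $\sigma\in[0,\infty)$ such that there exist $\delta>0$ and a continuous map $\mathcal H:B(u,\delta)\times[0,\delta]\to X$ ($B(u,\delta)$ the open ball) with $d(\mathcal H(v,t),v)\le t$ and $g(\mathcal H(v,t))\le g(v)-\sigma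 t$ for all $v\in B(u,\delta)$, $t\in[0,\delta]$. $(SBPS)_c$-sequence (symmetric bounded Palais-Smale sequence at level $c\in\mathbb R$) for a continuous $g:X\to\mathbb R$: a sequence $(u_n)\subset X$ that is bounded in $X$ and satisfies $|dg|(u_n)\to0$, $g(u_n)\to c$ and $\|u_n-u_n^*\|_V\to0$. The functional $g$ satisfies the condition $(SBPS)_c$ if every $(SBPS)_c$-sequence for $g$ admits a subsequence converging in $X$. *)

theory Defs
  imports "HOL-Analysis.Analysis"
begin

text \<open>
  The space \<open>H\<^sub>*\<close> of the framework is a type of class \<^class>\<open>topological_space\<close>.  The
  symmetrization, the polarization and the functionals below are total functions of
  HOL whose values outside the stated domains are never constrained.
\<close>

primrec iterated_polarization ::
  "('x \<Rightarrow> 'h \<Rightarrow> 'x) \<Rightarrow> (nat \<Rightarrow> 'h) \<Rightarrow> nat \<Rightarrow> 'x \<Rightarrow> 'x" where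
  "iterated_polarization pol H 0 u = u"
| "iterated_polarization pol H (Suc m) u = pol (iterated_polarization pol H m u) (H m)"

text \<open>
  The embedding of \<open>X\<close> into \<open>V\<close> is an explicit injective bounded linear map \<open>j\<close>, so that
  the \<open>V\<close>-norm of \<open>u \<in> X\<close> reads \<open>norm (j u)\<close>.
\<close>

locale symmetrization_framework =
  fixes j :: "'x::banach \<Rightarrow> 'v::banach"
    and S :: "'x set"
    and star :: "'x \<Rightarrow> 'x"
    and pol :: "'x \<Rightarrow> 'h::topological_space \<Rightarrow> 'x"
    and \<Theta> :: "'x \<Rightarrow> 'x"
  assumes path_connected_polarizers: "path_connected (UNIV :: 'h set)"
    and star_in: "\<And>u. u \<in> S \<Longrightarrow> star u \<in> S"
    and pol_in: "\<And>u H. u \<in> S \<Longrightarrow> pol u H \<in> S"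
    and embedding_bounded_linear: "bounded_linear j"
    and embedding_inj: "inj j"
    and pol_continuous: "continuous_on (S \<times> UNIV) (\<lambda>(u, H). pol u H)"
    and pol_star: "\<And>u H. u \<in> S \<Longrightarrow> pol (star u) H = star u"
    and star_pol: "\<And>u H. u \<in> S \<Longrightarrow> star (pol u H) = star u"
    and pol_idem: "\<And>u H. u \<in> S \<Longrightarrow> pol (pol u H) H = pol u H"
    and iterated_polarization_converges:
      "\<exists>H. \<forall>u\<in>S. (\<lambda>m. j (iterated_polarization pol H m u)) \<longlonglongrightarrow> j (star u)"
    and pol_nonexpansive:
      "\<And>u v H. u \<in> S \<Longrightarrow> v \<in> S \<Longrightarrow> norm (j (pol u H) - j (pol v H)) \<le> norm (j u - j v)"
    and Theta_in: "\<And>u. \<Theta> u \<in> S"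
    and Theta_id: "\<And>u. u \<in> S \<Longrightarrow> \<Theta> u = u"
    and Theta_lipschitz: "\<exists>L. \<forall>u v. norm (j (\<Theta> u) - j (\<Theta> v)) \<le> L * norm (j u - j v)"

definition extended_star :: "('x \<Rightarrow> 'x) \<Rightarrow> ('x \<Rightarrow> 'x) \<Rightarrow> 'x \<Rightarrow> 'x" where
  "extended_star star \<Theta> u = star (\<Theta> u)"

definition weak_slope :: "('a::metric_space \<Rightarrow> real) \<Rightarrow> 'a \<Rightarrow> ennreal" where
  "weak_slope g u = Sup {ennreal \<sigma> | \<sigma>. 0 \<le> \<sigma> \<and>
     (\<exists>\<delta>>0. \<exists>\<H> :: 'a \<times> real \<Rightarrow> 'a.
        continuous_on (ball u \<delta> \<times> {0..\<delta>}) \<H> \<and>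
        (\<forall>v\<in>ball u \<delta>. \<forall>t\<in>{0..\<delta>}.
           dist (\<H> (v, t)) v \<le> t \<and> g (\<H> (v, t)) \<le> g v - \<sigma> * t))}"

text \<open>In the next two definitions \<open>st\<close> stands for the symmetrization extended to all of \<open>X\<close>.\<close>

definition SBPS_sequence ::
  "('x::real_normed_vector \<Rightarrow> 'v::real_normed_vector) \<Rightarrow> ('x \<Rightarrow> 'x) \<Rightarrow> ('x \<Rightarrow> real) \<Rightarrow> real
     \<Rightarrow> (nat \<Rightarrow> 'x) \<Rightarrow> bool" where
  "SBPS_sequence j st g c u \<longleftrightarrow>
     bounded (range u) \<and>
     (\<lambda>n. weak_slope g (u n)) \<longlonglongrightarrow> 0 \<and>
     (\<lambda>n. g (u n)) \<longlonglongrightarrow> c \<and>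
     (\<lambda>n. norm (j (u n) - j (st (u n)))) \<longlonglongrightarrow> 0"

definition SBPS_condition ::
  "('x::real_normed_vector \<Rightarrow> 'v::real_normed_vector) \<Rightarrow> ('x \<Rightarrow> 'x) \<Rightarrow> ('x \<Rightarrow> real) \<Rightarrow> real
     \<Rightarrow> bool" where
  "SBPS_condition j st g c \<longleftrightarrow>
     (\<forall>u. SBPS_sequence j st g c u \<longrightarrow> (\<exists>r::nat \<Rightarrow> nat. strict_mono r \<and> convergent (u \<circ> r)))"

text \<open>
  The set \<open>C(A, X)\<close>.  Extensionality makes its elements correspond exactly to the
  continuous maps with domain \<open>A\<close>, so that the behaviour of a HOL function off \<open>A\<close> plays no role.
\<close>

definition continuous_maps ::
  "'a::topological_space set \<Rightarrow> ('a \<Rightarrow> 'b::topological_space) set" where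
  "continuous_maps A = {\<gamma> \<in> extensional A. continuous_on A \<gamma>}"

definition minimax_class ::
  "((real ^ 'm) \<Rightarrow> 'x::topological_space) set \<Rightarrow> ((real ^ 'm) \<Rightarrow> 'x) set" where
  "minimax_class \<Gamma>0 = {\<gamma> \<in> continuous_maps (cball 0 1). restrict \<gamma> (sphere 0 1) \<in> \<Gamma>0}"

text \<open>
  The two levels are taken in the extended reals, since neither the infimum nor the
  supremum over \<open>\<Gamma>0\<close> is finite a priori.
\<close>

definition minimax_level ::
  "(real \<Rightarrow> 'x::topological_space \<Rightarrow> real) \<Rightarrow> ((real ^ 'm) \<Rightarrow> 'x) set \<Rightarrow> real \<Rightarrow> ereal" where
  "minimax_level f \<Gamma>0 lam = (INF \<gamma>\<in>minimax_class \<Gamma>0. SUP t\<in>cball 0 1. ereal (f lam (\<gamma> t)))"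

definition boundary_level ::
  "(real \<Rightarrow> 'x \<Rightarrow> real) \<Rightarrow> ((real ^ 'm) \<Rightarrow> 'x) set \<Rightarrow> real \<Rightarrow> ereal" where
  "boundary_level f \<Gamma>0 lam = (SUP \<gamma>0\<in>\<Gamma>0. SUP \<tau>\<in>sphere 0 1. ereal (f lam (\<gamma>0 \<tau>)))"

text \<open>
  If the class is nonempty, each \<open>f lam\<close> is continuous and the minimax level exceeds the boundary
  level, then the minimax level is a real number, so passing to \<^const>\<open>real_of_ereal\<close>
  loses nothing.
\<close>

lemma minimax_level_finite:
  fixes \<Gamma>0 :: "((real ^ 'm) \<Rightarrow> 'x::topological_space) set"
  assumes ne: "minimax_class \<Gamma>0 \<noteq> {}"
    and cont: "continuous_on UNIV (f lam)"
    and gap: "minimax_level f \<Gamma>0 lam > boundary_level f \<Gamma>0 lam"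
  shows "ereal (real_of_ereal (minimax_level f \<Gamma>0 lam)) = minimax_level f \<Gamma>0 lam"
proof -
  obtain \<gamma> where \<gamma>: "\<gamma> \<in> minimax_class \<Gamma>0" using ne by auto
  have cg: "continuous_on (cball 0 1) (\<lambda>t. f lam (\<gamma> t))"
    using \<gamma> continuous_on_compose2[OF cont, of "cball 0 1" \<gamma>]
    by (auto simp: minimax_class_def continuous_maps_def)
  obtain B where B: "\<And>t. t \<in> cball 0 1 \<Longrightarrow> f lam (\<gamma> t) \<le> B"
    using continuous_attains_sup[OF compact_cball _ cg] by fastforce
  have "minimax_level f \<Gamma>0 lam \<le> (SUP t\<in>cball 0 1. ereal (f lam (\<gamma> t)))"
    unfolding minimax_level_def by (rule INF_lower[OF \<gamma>])
  also have "\<dots> \<le> ereal B" by (rule SUP_least) (use B in auto)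
  finally have "minimax_level f \<Gamma>0 lam \<noteq> \<infinity>" by auto
  moreover have "minimax_level f \<Gamma>0 lam \<noteq> -\<infinity>" using gap by auto
  ultimately show ?thesis by (cases "minimax_level f \<Gamma>0 lam") auto
qed

end

theory Submission
  imports Defs
begin

text \<open>
  Let \<open>c(\<lambda>)\<close> be the minimax level.  By a theorem of Denjoy the upper left derivate of an arbitrary real
  function is \<open>-\<infinity>\<close> only on a null set, so at almost every \<open>\<lambda>\<close> there are \<open>\<lambda>\<^sub>h\<close> increasing to \<open>\<lambda>\<close> with
  \<open>c(\<lambda>\<^sub>h) \<le> c(\<lambda>) + K (\<lambda> - \<lambda>\<^sub>h)\<close>.  Take a map of the minimax class that is almost optimal for \<open>\<lambda>\<^sub>h\<close>.
  Hypothesis (ii) bounds those of its values at which \<open>f \<lambda>\<close> is at least \<open>c(\<lambda>)\<close>, and makes the map almost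
  optimal for \<open>\<lambda>\<close>.  Polarizing the map does not increase any \<open>f \<lambda>\<close>, hence preserves these properties, and
  makes it almost symmetric away from the boundary sphere, where \<open>f \<lambda>\<close> stays below \<open>c(\<lambda>)\<close>.  Ekeland's
  principle in the space of maps then gives, near an almost optimal polarized map, a map that cannot be
  lowered at a fixed rate; a local deformation built from the weak slope shows that one of its maximum
  points has small weak slope.  These points form a symmetric bounded Palais-Smale sequence.
\<close>

subsection \<open>Left derivates of an arbitrary function\<close>

text \<open>
  On each piece of length below \<open>w\<close> the set \<open>B\<close> lies in an interval whose length is the decrease of \<open>G\<close>
  over the piece divided by \<open>K\<close>, and these decreases telescope.
\<close>

lemma outer_cover_steep:
  fixes c G :: "real \<Rightarrow> real" and B :: "real set"
  assumes "K > 0" "w > 0" and B: "B \<subseteq> {a..b}"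
    and anti: "antimono G" and G: "\<And>x. x \<in> B \<Longrightarrow> G x = c x"
    and range: "\<And>x. \<bar>G x\<bar> \<le> R"
    and steep: "\<And>x y. x \<in> B \<Longrightarrow> y \<in> B \<Longrightarrow> x - w < y \<Longrightarrow> y < x \<Longrightarrow> K * (x - y) \<le> c y - c x"
  shows "\<exists>U. B \<subseteq> U \<and> U \<in> lmeasurable \<and> measure lebesgue U \<le> 2 * R / K"
proof -
  define v where "v = w / 2"
  have v: "0 < v" "v < w" using \<open>w > 0\<close> by (auto simp: v_def)
  obtain p :: nat where p: "b < a + real p * v"
    using reals_Archimedean3[OF v(1), rule_format, of "b - a"] by (auto simp: algebra_simps)
  define X where "X i = a + real i * v" for i :: nat
  define L where "L i = (G (X i) - G (X (Suc i))) / K" for i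
  have XS: "X (Suc i) = X i + v" for i by (simp add: X_def algebra_simps)
  have L0: "L i \<ge> 0" for i
    using antimonoD[OF anti, of "X i" "X (Suc i)"] v \<open>K > 0\<close> by (auto simp: L_def XS)
  have "\<exists>z. B \<inter> {X i..X (Suc i)} \<subseteq> {z..z + L i}" for i
  proof (cases "B \<inter> {X i..X (Suc i)} = {}")
    case False
    let ?J = "B \<inter> {X i..X (Suc i)}"
    have bdd: "bdd_below ?J" by (rule bdd_belowI[of _ "X i"]) auto
    have "x - L i \<le> y" if "x \<in> ?J" "y \<in> ?J" for x y
    proof (cases "y < x")
      case True
      have "K * (x - y) \<le> c y - c x" using that True v by (intro steep) (auto simp: XS)
      also have "\<dots> = G y - G x" using that G by auto
      also have "\<dots> \<le> G (X i) - G (X (Suc i))"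
        using that antimonoD[OF anti] by (intro diff_mono) auto
      finally show ?thesis using \<open>K > 0\<close> by (simp add: L_def field_simps)
    qed (use L0[of i] in linarith)
    then have "x - L i \<le> Inf ?J" if "x \<in> ?J" for x
      using that by (intro cInf_greatest[OF False]) auto
    moreover have "Inf ?J \<le> x" if "x \<in> ?J" for x using that bdd by (rule cInf_lower)
    ultimately have "?J \<subseteq> {Inf ?J..Inf ?J + L i}" by (auto simp: algebra_simps)
    then show ?thesis by blast
  qed auto
  then obtain z where z: "\<And>i. B \<inter> {X i..X (Suc i)} \<subseteq> {z i..z i + L i}" by metis
  let ?U = "\<Union>i<p. {z i..z i + L i}"
  have "B \<subseteq> ?U"
  proof
    fix x assume x: "x \<in> B"
    define i where "i = nat \<lfloor>(x - a) / v\<rfloor>"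
    have "a \<le> x" "x \<le> b" using x B by auto
    then have ge: "(x - a) / v \<ge> 0" using v by simp
    have fl: "real i \<le> (x - a) / v" "(x - a) / v < real i + 1"
      using ge unfolding i_def by (simp_all add: of_nat_nat)
    then have "real i * v \<le> x - a" "x - a < (real i + 1) * v" using v by (simp_all add: field_simps)
    then have "x \<in> {X i..X (Suc i)}" by (auto simp: X_def algebra_simps)
    moreover have "real i * v < real p * v" using \<open>real i * v \<le> x - a\<close> p \<open>x \<le> b\<close> by linarith
    then have "i < p" using v by simp
    ultimately show "x \<in> ?U" using z[of i] x by blast
  qed
  moreover have "?U \<in> lmeasurable" by (intro fmeasurable.finite_UN) auto
  moreover have "measure lebesgue ?U \<le> 2 * R / K"
  proof -
    have "measure lebesgue ?U \<le> (\<Sum>i<p. measure lebesgue {z i..z i + L i})"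
      by (intro measure_UNION_le) auto
    also have "\<dots> = (\<Sum>i<p. L i)" using L0 by (intro sum.cong) auto
    also have "\<dots> = (\<Sum>i<p. G (X i) - G (X (Suc i))) / K" by (simp add: L_def sum_divide_distrib)
    also have "(\<Sum>i<p. G (X i) - G (X (Suc i))) = G (X 0) - G (X p)"
      by (rule sum_lessThan_telescope')
    also have "\<dots> \<le> 2 * R" using range[of "X 0"] range[of "X p"] by linarith
    finally show ?thesis using \<open>K > 0\<close> by (simp add: divide_right_mono)
  qed
  ultimately show ?thesis by blast
qed

lemma negligible_steep_monotone:
  fixes c :: "real \<Rightarrow> real" and N :: "real set"
  assumes N: "N \<subseteq> {a..b}" and R: "\<And>x. x \<in> N \<Longrightarrow> \<bar>c x\<bar> \<le> R"
    and anti: "\<And>x y. x \<in> N \<Longrightarrow> y \<in> N \<Longrightarrow> y \<le> x \<Longrightarrow> c x \<le> c y"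
    and steep: "\<And>K x. x \<in> N \<Longrightarrow> \<exists>d>0. \<forall>y\<in>N. x - d < y \<and> y < x \<longrightarrow> K * (x - y) \<le> c y - c x"
  shows "negligible N"
  unfolding negligible_outer_le
proof (intro allI impI)
  fix e :: real assume e: "e > 0"
  define K where "K = 2 * \<bar>R\<bar> / e + 1"
  have K: "K > 0" using e by (auto simp: K_def intro!: add_nonneg_pos)
  have Ke: "2 * \<bar>R\<bar> / K \<le> e" using e K by (simp add: K_def field_simps)
  define G where "G x = Inf (insert \<bar>R\<bar> (c ` (N \<inter> {..x})))" for x
  have bdd: "bdd_below (insert \<bar>R\<bar> (c ` (N \<inter> {..x})))" for x
    by (rule bdd_belowI[of _ "- \<bar>R\<bar>"]) (use R in \<open>force simp: abs_le_iff\<close>)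
  have G: "G x = c x" if "x \<in> N" for x
  proof (rule antisym)
    show "G x \<le> c x" unfolding G_def using that by (intro cInf_lower bdd) auto
    show "c x \<le> G x" unfolding G_def
      by (rule cInf_greatest) (use that R[OF that] anti in auto)
  qed
  have antiG: "antimono G" unfolding G_def
    by (intro antimonoI cInf_superset_mono bdd) auto
  have rangeG: "\<bar>G x\<bar> \<le> \<bar>R\<bar>" for x
  proof -
    have "G x \<le> \<bar>R\<bar>" unfolding G_def by (intro cInf_lower bdd) auto
    moreover have "- \<bar>R\<bar> \<le> G x" unfolding G_def
      by (rule cInf_greatest) (use R in \<open>force simp: abs_le_iff\<close>)+
    ultimately show ?thesis by auto
  qed
  define B where "B m = {x \<in> N. \<forall>y\<in>N. x - 1 / real (Suc m) < y \<and> y < x \<longrightarrow> K * (x - y) \<le> c y - c x}"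
    for m
  have "\<exists>U. B m \<subseteq> U \<and> U \<in> lmeasurable \<and> measure lebesgue U \<le> 2 * \<bar>R\<bar> / K" for m
    by (rule outer_cover_steep[OF K, of "1 / real (Suc m)" "B m" a b G c "\<bar>R\<bar>"])
       (use N antiG G rangeG in \<open>auto simp: B_def\<close>)
  then obtain U where U: "\<And>m. B m \<subseteq> U m" "\<And>m. U m \<in> lmeasurable"
    "\<And>m. measure lebesgue (U m) \<le> e" using Ke by (metis order_trans)
  define W where "W m = (\<Inter>k\<in>{m..}. U k)" for m
  have Wsets: "W m \<in> sets lebesgue" for m unfolding W_def using U(2)
    by (intro sets.countable_INT') (auto simp: fmeasurableD)
  have Bmono: "B m \<subseteq> B k" if "m \<le> k" for m k
  proof -
    have "1 / real (Suc k) \<le> 1 / real (Suc m)" using that by (simp add: frac_le)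
    then show ?thesis by (force simp: B_def)
  qed
  have emW: "emeasure lebesgue (W m) \<le> ennreal e" for m
  proof -
    have "emeasure lebesgue (W m) \<le> emeasure lebesgue (U m)"
      using U(2) by (intro emeasure_mono) (auto simp: W_def fmeasurableD)
    also have "\<dots> = ennreal (measure lebesgue (U m))" using U(2) by (rule emeasure_eq_measure2)
    finally show ?thesis using U(3)[of m] ennreal_leI order_trans by blast
  qed
  have "incseq W" unfolding W_def incseq_def by force
  then have "emeasure lebesgue (\<Union>m. W m) = (SUP m. emeasure lebesgue (W m))"
    using Wsets by (intro SUP_emeasure_incseq[symmetric]) auto
  also have "\<dots> \<le> ennreal e" by (intro SUP_least emW)
  finally have le: "emeasure lebesgue (\<Union>m. W m) \<le> ennreal e" .
  have "N \<subseteq> (\<Union>m. W m)"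
  proof
    fix x assume x: "x \<in> N"
    obtain d where d: "d > 0" "\<forall>y\<in>N. x - d < y \<and> y < x \<longrightarrow> K * (x - y) \<le> c y - c x"
      using steep[OF x] by blast
    obtain m where "1 / real (Suc m) < d" using nat_approx_posE[OF d(1)] .
    then have "x \<in> B m" using x d(2) by (auto simp: B_def)
    then have "x \<in> W m" using Bmono U(1) unfolding W_def by blast
    then show "x \<in> (\<Union>m. W m)" by blast
  qed
  moreover have "(\<Union>m. W m) \<in> lmeasurable" using Wsets le
    by (intro fmeasurableI) (auto intro: le_less_trans)
  moreover have "measure lebesgue (\<Union>m. W m) \<le> e"
    using enn2real_mono[OF le] e by (simp add: measure_def)
  ultimately show "\<exists>T. N \<subseteq> T \<and> T \<in> lmeasurable \<and> measure lebesgue T \<le> e" by blast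
qed

lemma negligible_left_slope_minus_infinity:
  fixes c :: "real \<Rightarrow> real" and A :: "real set"
  shows "negligible {x \<in> A. \<forall>K. \<exists>d>0. \<forall>y\<in>A. x - d < y \<and> y < x \<longrightarrow> K * (x - y) \<le> c y - c x}"
    (is "negligible ?E")
proof -
  define E where "E n R = {x \<in> ?E. \<bar>c x\<bar> \<le> real R \<and>
    (\<forall>y\<in>A. x - 1 / real (Suc n) < y \<and> y < x \<longrightarrow> c x \<le> c y)}" for n R :: nat
  have "?E \<subseteq> (\<Union>n. \<Union>R. E n R)"
  proof
    fix x assume x: "x \<in> ?E"
    then obtain d where d: "d > 0" "\<forall>y\<in>A. x - d < y \<and> y < x \<longrightarrow> 0 * (x - y) \<le> c y - c x" by blast
    obtain n where "1 / real (Suc n) < d" using nat_approx_posE[OF d(1)] .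
    moreover obtain R :: nat where "\<bar>c x\<bar> \<le> real R" using real_arch_simple by blast
    ultimately have "x \<in> E n R" using x d(2) unfolding E_def by auto
    then show "x \<in> (\<Union>n. \<Union>R. E n R)" by blast
  qed
  moreover have "negligible (E n R)" for n R
    unfolding locally_negligible_alt[of "E n R"]
  proof
    fix x assume x: "x \<in> E n R"
    define r where "r = 1 / (2 * real (Suc n))"
    have r: "r > 0" "2 * r = 1 / real (Suc n)" by (auto simp: r_def divide_simps)
    let ?U = "E n R \<inter> {x - r<..<x + r}"
    have "negligible ?U"
    proof (rule negligible_steep_monotone[of ?U "x - r" "x + r" c "real R"])
      show "c u \<le> c y" if "u \<in> ?U" "y \<in> ?U" "y \<le> u" for u y
      proof (cases "y = u")
        case False
        then show ?thesis using that r by (auto simp: E_def)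
      qed simp
      show "\<exists>d>0. \<forall>y\<in>?U. u - d < y \<and> y < u \<longrightarrow> K * (u - y) \<le> c y - c u" if "u \<in> ?U" for u K
      proof -
        have "u \<in> ?E" using that by (auto simp: E_def)
        then obtain d where "d > 0" "\<forall>y\<in>A. u - d < y \<and> y < u \<longrightarrow> K * (u - y) \<le> c y - c u"
          by blast
        then show ?thesis by (intro exI[of _ d]) (auto simp: E_def)
      qed
    qed (auto simp: E_def)
    moreover have "openin (top_of_set (E n R)) ?U" by (auto simp: openin_open)
    ultimately show "\<exists>U. openin (top_of_set (E n R)) U \<and> x \<in> U \<and> negligible U"
      using x r by (intro exI[of _ ?U]) auto
  qed
  then have "negligible (\<Union>n. \<Union>R. E n R)" by (intro negligible_Union_nat)
  ultimately show ?thesis using negligible_subset by blast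
qed

lemma AE_left_sequence_bounded_slope:
  fixes c :: "real \<Rightarrow> real" and A :: "real set"
  shows "AE x in lebesgue. x \<in> A \<longrightarrow> (\<exists>K xs. (\<forall>h::nat. xs h \<in> A) \<and> strict_mono xs \<and> xs \<longlonglongrightarrow> x \<and>
     (\<forall>h. c (xs h) - c x \<le> K * (x - xs h)))"
proof -
  let ?E = "{x \<in> A. \<forall>K. \<exists>d>0. \<forall>y\<in>A. x - d < y \<and> y < x \<longrightarrow> K * (x - y) \<le> c y - c x}"
  have null: "?E \<in> null_sets lebesgue"
    using negligible_left_slope_minus_infinity negligible_iff_null_sets by blast
  show ?thesis
  proof (rule AE_I'[OF null], rule subsetI, rule ccontr)
    fix x
    assume x: "x \<in> {x \<in> space lebesgue. \<not> (x \<in> A \<longrightarrow>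
        (\<exists>K xs. (\<forall>h::nat. xs h \<in> A) \<and> strict_mono xs \<and> xs \<longlonglongrightarrow> x \<and>
          (\<forall>h. c (xs h) - c x \<le> K * (x - xs h))))}" and "x \<notin> ?E"
    then obtain K where K: "\<And>d. d > 0 \<Longrightarrow> \<exists>y\<in>A. x - d < y \<and> y < x \<and> c y - c x \<le> K * (x - y)"
      by (auto simp: not_le) (meson less_imp_le)
    define Q where "Q y \<longleftrightarrow> y \<in> A \<and> y < x \<and> c y - c x \<le> K * (x - y)" for y
    have "\<exists>xs. \<forall>n. (Q (xs n) \<and> x - 1 / real (Suc n) < xs n) \<and> xs n < xs (Suc n)"
    proof (rule dependent_nat_choice)
      show "\<exists>y. Q y \<and> x - 1 / real (Suc 0) < y" using K[of 1] by (auto simp: Q_def)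
      fix y and n :: nat assume y: "Q y \<and> x - 1 / real (Suc n) < y"
      have "min (x - y) (1 / real (Suc (Suc n))) > 0" using y by (simp add: Q_def)
      from K[OF this] show "\<exists>z. (Q z \<and> x - 1 / real (Suc (Suc n)) < z) \<and> y < z"
        by (auto simp: Q_def)
    qed
    then obtain xs where xs: "\<And>n. Q (xs n)" "\<And>n. x - 1 / real (Suc n) < xs n" "\<And>n. xs n < xs (Suc n)"
      by blast
    have "xs \<longlonglongrightarrow> x"
    proof (rule real_tendsto_sandwich)
      show "(\<lambda>n. x - 1 / real (Suc n)) \<longlonglongrightarrow> x"
        using tendsto_diff[OF tendsto_const LIMSEQ_inverse_real_of_nat, of x] by (simp add: inverse_eq_divide)
      show "(\<lambda>n. x) \<longlonglongrightarrow> x" by simp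
    qed (use xs in \<open>auto simp: Q_def intro!: always_eventually less_imp_le\<close>)
    moreover have "strict_mono xs" using xs(3) by (simp add: strict_mono_Suc_iff)
    ultimately show False using x xs(1) by (auto simp: Q_def)
  qed
qed

subsection \<open>Weak slope and descent deformations\<close>

lemma weak_slope_greaterE:
  fixes g :: "'a::metric_space \<Rightarrow> real"
  assumes "ennreal e < weak_slope g u" and "0 \<le> e"
  obtains d \<H> where "d > 0" "continuous_on (ball u d \<times> {0..d}) \<H>"
    "\<And>v t. v \<in> ball u d \<Longrightarrow> t \<in> {0..d} \<Longrightarrow> dist (\<H> (v, t)) v \<le> t"
    "\<And>v t. v \<in> ball u d \<Longrightarrow> t \<in> {0..d} \<Longrightarrow> g (\<H> (v, t)) \<le> g v - e * t"
proof -
  from assms obtain \<sigma> d and \<H> :: "'a \<times> real \<Rightarrow> 'a" where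
    \<sigma>: "ennreal e < ennreal \<sigma>" "0 \<le> \<sigma>" and d: "d > 0" "continuous_on (ball u d \<times> {0..d}) \<H>"
    and H: "\<forall>v\<in>ball u d. \<forall>t\<in>{0..d}. dist (\<H> (v, t)) v \<le> t \<and> g (\<H> (v, t)) \<le> g v - \<sigma> * t"
    unfolding weak_slope_def less_Sup_iff by blast
  have "e < \<sigma>" using \<sigma> by (metis ennreal_leI not_le)
  then have "g (\<H> (v, t)) \<le> g v - e * t" if "v \<in> ball u d" "t \<in> {0..d}" for v t
    using H that mult_right_mono[of e \<sigma> t] by fastforce
  with that d H show thesis by blast
qed

lemma weak_slope_ge:
  fixes g :: "'a::metric_space \<Rightarrow> real"
  assumes "0 \<le> e" "d > 0" "continuous_on (ball u d \<times> {0..d}) \<H>"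
    and "\<And>v t. v \<in> ball u d \<Longrightarrow> t \<in> {0..d} \<Longrightarrow> dist (\<H> (v, t)) v \<le> t"
    and "\<And>v t. v \<in> ball u d \<Longrightarrow> t \<in> {0..d} \<Longrightarrow> g (\<H> (v, t)) \<le> g v - e * t"
  shows "ennreal e \<le> weak_slope g u"
  unfolding weak_slope_def by (rule Sup_upper) (use assms in blast)

lemma weak_slope_eq_0_limit:
  fixes g :: "'a::metric_space \<Rightarrow> real"
  assumes lim: "u \<longlonglongrightarrow> x" and slope: "(\<lambda>n. weak_slope g (u n)) \<longlonglongrightarrow> 0"
  shows "weak_slope g x = 0"
proof (rule ccontr)
  assume "weak_slope g x \<noteq> 0"
  then have "0 < weak_slope g x" by (simp add: zero_less_iff_neq_zero)
  then obtain e' where e': "0 < e'" "e' < weak_slope g x" using dense by blast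
  then obtain e where e: "0 < e" "e' = ennreal e" by (cases e') auto
  then obtain d \<H> where d: "d > 0" "continuous_on (ball x d \<times> {0..d}) \<H>"
    "\<And>v t. v \<in> ball x d \<Longrightarrow> t \<in> {0..d} \<Longrightarrow> dist (\<H> (v, t)) v \<le> t"
    "\<And>v t. v \<in> ball x d \<Longrightarrow> t \<in> {0..d} \<Longrightarrow> g (\<H> (v, t)) \<le> g v - e * t"
    using weak_slope_greaterE[of e g x] e'(2) by (metis less_imp_le)
  have ge: "ennreal e \<le> weak_slope g v" if v: "dist x v < d / 2" for v
  proof (rule weak_slope_ge)
    have sub: "ball v (d/2) \<subseteq> ball x d"
    proof
      fix z assume "z \<in> ball v (d/2)"
      then show "z \<in> ball x d" using v dist_triangle[of x z v] by simp
    qed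
    show "continuous_on (ball v (d/2) \<times> {0..d/2}) \<H>"
      by (rule continuous_on_subset[OF d(2)]) (use sub d(1) in auto)
    fix z t assume "z \<in> ball v (d/2)" "t \<in> {0..d/2}"
    then have "z \<in> ball x d" "t \<in> {0..d}" using sub d(1) by auto
    then show "dist (\<H> (z, t)) z \<le> t" "g (\<H> (z, t)) \<le> g z - e * t" using d(3,4) by blast+
  qed (use e d(1) in auto)
  have "\<forall>\<^sub>F n in sequentially. dist (u n) x < d / 2" using lim d(1) by (intro tendstoD) auto
  moreover have "\<forall>\<^sub>F n in sequentially. weak_slope g (u n) < ennreal e"
    using slope e by (intro order_tendstoD) auto
  ultimately have "\<forall>\<^sub>F n in sequentially. False"
    by eventually_elim (use ge in \<open>simp add: dist_commute not_le[symmetric]\<close>)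
  then show False by simp
qed

lemma finite_descent:
  fixes g :: "'a::metric_space \<Rightarrow> real" and w :: "'i \<Rightarrow> 'a \<Rightarrow> real"
  assumes "finite I" and "0 \<le> e" "0 \<le> s"
    and s: "\<And>i. i \<in> I \<Longrightarrow> s \<le> d i / 2"
    and cont: "\<And>i. i \<in> I \<Longrightarrow> continuous_on (ball (z i) (d i) \<times> {0..d i}) (\<H> i)"
    and dist: "\<And>i v t. i \<in> I \<Longrightarrow> v \<in> ball (z i) (d i) \<Longrightarrow> t \<in> {0..d i} \<Longrightarrow> dist (\<H> i (v, t)) v \<le> t"
    and desc: "\<And>i v t. i \<in> I \<Longrightarrow> v \<in> ball (z i) (d i) \<Longrightarrow> t \<in> {0..d i} \<Longrightarrow>
        g (\<H> i (v, t)) \<le> g v - e * t"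
    and w: "\<And>i. i \<in> I \<Longrightarrow> continuous_on UNIV (w i)" "\<And>i v. i \<in> I \<Longrightarrow> 0 \<le> w i v"
      "\<And>v. (\<Sum>i\<in>I. w i v) \<le> 1" "\<And>i v. i \<in> I \<Longrightarrow> w i v \<noteq> 0 \<Longrightarrow> dist (z i) v < d i / 2"
  shows "\<exists>\<eta>. continuous_on UNIV \<eta> \<and> (\<forall>v. dist (\<eta> v) v \<le> s * (\<Sum>i\<in>I. w i v)) \<and>
     (\<forall>v. g (\<eta> v) \<le> g v - e * (s * (\<Sum>i\<in>I. w i v)))"
  using assms
proof (induction I rule: finite_induct)
  case empty
  show ?case by (intro exI[of _ id]) auto
next
  case (insert i I)
  have sum: "(\<Sum>k\<in>insert i I. w k v) = w i v + (\<Sum>k\<in>I. w k v)" for v using insert.hyps by simp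
  have w0: "0 \<le> w i v" "0 \<le> (\<Sum>k\<in>I. w k v)" for v using insert.prems by (auto intro!: sum_nonneg)
  have w1: "w i v \<le> 1" "(\<Sum>k\<in>I. w k v) \<le> 1" for v
    using insert.prems(9)[of v] w0[of v] sum[of v] by linarith+
  have "\<exists>\<eta>. continuous_on UNIV \<eta> \<and> (\<forall>v. dist (\<eta> v) v \<le> s * (\<Sum>i\<in>I. w i v)) \<and>
     (\<forall>v. g (\<eta> v) \<le> g v - e * (s * (\<Sum>i\<in>I. w i v)))"
  proof (rule insert.IH)
    show "(\<Sum>i\<in>I. w i v) \<le> 1" for v by (rule w1(2))
  qed (rule insert.prems; assumption?; rule insertI2; assumption)+
  then obtain \<eta> where \<eta>: "continuous_on UNIV \<eta>" "\<And>v. dist (\<eta> v) v \<le> s * (\<Sum>i\<in>I. w i v)"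
    "\<And>v. g (\<eta> v) \<le> g v - e * (s * (\<Sum>i\<in>I. w i v))" by blast
  let ?U = "ball (z i) (d i / 2)"
  have sd: "s \<le> d i / 2" using insert.prems by auto
  have in_ball: "\<eta> v \<in> ball (z i) (d i)" if "v \<in> ?U" for v
  proof -
    have "dist (z i) (\<eta> v) \<le> dist (z i) v + dist v (\<eta> v)" by (rule dist_triangle)
    moreover have "dist v (\<eta> v) \<le> s"
      using \<eta>(2)[of v] mult_left_mono[OF w1(2)[of v] \<open>0 \<le> s\<close>] by (simp add: dist_commute)
    ultimately show ?thesis using that sd by simp
  qed
  have time: "s * w i v \<in> {0..d i}" for v
    using mult_left_mono[OF w1(1)[of v] \<open>0 \<le> s\<close>] w0[of v] sd \<open>0 \<le> s\<close> by auto
  define \<xi> where "\<xi> v = (if v \<in> ?U then \<H> i (\<eta> v, s * w i v) else \<eta> v)" for v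
  have d\<xi>: "dist (\<xi> v) (\<eta> v) \<le> s * w i v" for v
    using insert.prems(5)[of i, OF _ in_ball time] w0(1)[of v] \<open>0 \<le> s\<close> by (auto simp: \<xi>_def)
  have g\<xi>: "g (\<xi> v) \<le> g (\<eta> v) - e * (s * w i v)" for v
  proof (cases "v \<in> ?U")
    case True
    then show ?thesis using insert.prems(6)[of i, OF _ in_ball time] by (simp add: \<xi>_def)
  next
    case False
    then have "w i v = 0" using insert.prems(10)[of i v] by auto
    then show ?thesis using False by (simp add: \<xi>_def)
  qed
  have "isCont \<xi> v" for v
  proof (cases "v \<in> ?U")
    case True
    have "continuous_on ?U \<eta>" "continuous_on ?U (w i)"
      using \<eta>(1) insert.prems(7)[of i] by (auto intro: continuous_on_subset)
    then have "continuous_on ?U (\<lambda>v. (\<eta> v, s * w i v))" by (intro continuous_intros)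
    then have "continuous_on ?U (\<lambda>v. \<H> i (\<eta> v, s * w i v))"
      by (rule continuous_on_compose2[OF insert.prems(4)[OF insertI1]]) (use in_ball time in blast)
    then have "continuous_on ?U \<xi>" by (rule continuous_on_eq) (simp add: \<xi>_def)
    then show ?thesis using True by (simp add: continuous_on_eq_continuous_at)
  next
    case False
    have wv: "w i v = 0" using False insert.prems(10)[of i v] by auto
    have \<xi>v: "\<xi> v = \<eta> v" using False by (simp add: \<xi>_def)
    have "((\<lambda>y. dist (\<xi> y) (\<xi> v)) \<longlongrightarrow> 0) (at v)"
    proof (rule tendsto_sandwich[OF _ _ tendsto_const])
      have "(\<eta> \<longlongrightarrow> \<eta> v) (at v)" "(w i \<longlongrightarrow> w i v) (at v)"
        using \<eta>(1) insert.prems(7)[of i] by (auto simp: continuous_on_eq_continuous_at isCont_def)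
      then have "((\<lambda>y. dist (\<eta> y) (\<eta> v) + s * w i y) \<longlongrightarrow> dist (\<eta> v) (\<eta> v) + s * w i v) (at v)"
        by (intro tendsto_intros)
      then show "((\<lambda>y. dist (\<eta> y) (\<eta> v) + s * w i y) \<longlongrightarrow> 0) (at v)" using wv by simp
      have "dist (\<xi> y) (\<xi> v) \<le> dist (\<eta> y) (\<eta> v) + s * w i y" for y
        using d\<xi>[of y] dist_triangle[of "\<xi> y" "\<eta> v" "\<eta> y"] \<xi>v by simp
      then show "\<forall>\<^sub>F y in at v. dist (\<xi> y) (\<xi> v) \<le> dist (\<eta> y) (\<eta> v) + s * w i y"
        by (intro always_eventually allI)
    qed auto
    then show ?thesis unfolding isCont_def by (subst tendsto_dist_iff)
  qed
  then have "continuous_on UNIV \<xi>" by (simp add: continuous_at_imp_continuous_on)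
  moreover have "dist (\<xi> v) v \<le> s * (\<Sum>k\<in>insert i I. w k v)" for v
    using dist_triangle[of "\<xi> v" v "\<eta> v"] d\<xi>[of v] \<eta>(2)[of v] sum[of v]
    by (simp add: algebra_simps)
  moreover have "g (\<xi> v) \<le> g v - e * (s * (\<Sum>k\<in>insert i I. w k v))" for v
    using g\<xi>[of v] \<eta>(3)[of v] sum[of v] by (simp add: algebra_simps)
  ultimately show ?case by blast
qed

text \<open>The factor \<open>max 0 (g v - b)\<close> of the weights is what keeps the sublevel \<open>g \<le> b\<close> fixed.\<close>

lemma local_descent:
  fixes g :: "'a::metric_space \<Rightarrow> real"
  assumes g: "continuous_on UNIV g" and K: "compact K" "K \<noteq> {}" and "0 \<le> e"
    and slope: "\<And>v. v \<in> K \<Longrightarrow> ennreal e < weak_slope g v" and b: "\<And>v. v \<in> K \<Longrightarrow> b < g v"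
  obtains s0 U where "s0 > 0" "open U" "K \<subseteq> U"
    "\<And>s. 0 < s \<Longrightarrow> s \<le> s0 \<Longrightarrow> \<exists>\<eta>. continuous_on UNIV \<eta> \<and> (\<forall>v. dist (\<eta> v) v \<le> s \<and> g (\<eta> v) \<le> g v) \<and>
       (\<forall>v. g v \<le> b \<longrightarrow> \<eta> v = v) \<and> (\<forall>v\<in>U. g (\<eta> v) \<le> g v - e * s)"
proof -
  define Q where "Q u d \<H> \<longleftrightarrow> d > 0 \<and> continuous_on (ball u d \<times> {0..d}) \<H> \<and>
    (\<forall>v\<in>ball u d. \<forall>t\<in>{0..d}. dist (\<H> (v, t)) v \<le> t \<and> g (\<H> (v, t)) \<le> g v - e * t)" for u d \<H>
  have "\<exists>d \<H>. Q u d \<H>" if u: "u \<in> K" for u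
    using weak_slope_greaterE[OF slope[OF u] \<open>0 \<le> e\<close>] unfolding Q_def by (metis (no_types))
  then obtain d \<H> where "\<And>u. u \<in> K \<Longrightarrow> Q u (d u) (\<H> u)" by metis
  then have H: "\<And>u. u \<in> K \<Longrightarrow> d u > 0"
    "\<And>u. u \<in> K \<Longrightarrow> continuous_on (ball u (d u) \<times> {0..d u}) (\<H> u)"
    "\<And>u v t. u \<in> K \<Longrightarrow> v \<in> ball u (d u) \<Longrightarrow> t \<in> {0..d u} \<Longrightarrow> dist (\<H> u (v, t)) v \<le> t"
    "\<And>u v t. u \<in> K \<Longrightarrow> v \<in> ball u (d u) \<Longrightarrow> t \<in> {0..d u} \<Longrightarrow> g (\<H> u (v, t)) \<le> g v - e * t"
    unfolding Q_def by blast+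
  obtain I where I: "I \<subseteq> K" "finite I" "K \<subseteq> (\<Union>u\<in>I. ball u (d u / 2))"
    using compactE_image[OF K(1), of K "\<lambda>u. ball u (d u / 2)"] H(1) by force
  have "I \<noteq> {}" using I K by auto
  define \<phi> where "\<phi> u v = max 0 (d u / 2 - dist u v) * max 0 (g v - b)" for u v
  define \<Phi> where "\<Phi> v = (\<Sum>u\<in>I. \<phi> u v)" for v
  have \<phi>0: "0 \<le> \<phi> u v" for u v by (simp add: \<phi>_def)
  have c\<phi>: "continuous_on A (\<phi> u)" for u A unfolding \<phi>_def
    by (intro continuous_intros continuous_on_subset[OF g]) auto
  have c\<Phi>: "continuous_on A \<Phi>" for A unfolding \<Phi>_def by (intro continuous_intros c\<phi>)
  have \<Phi>0: "0 \<le> \<Phi> v" for v unfolding \<Phi>_def by (intro sum_nonneg \<phi>0)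
  have \<Phi>pos: "0 < \<Phi> v" if v: "v \<in> K" for v
  proof -
    obtain u where "u \<in> I" "dist u v < d u / 2" using I(3) v by auto
    then show ?thesis unfolding \<Phi>_def using I(2) b[OF v] \<phi>0
      by (intro sum_pos2[of I u]) (auto simp: \<phi>_def)
  qed
  obtain v0 where v0: "v0 \<in> K" "\<And>v. v \<in> K \<Longrightarrow> \<Phi> v0 \<le> \<Phi> v"
    using continuous_attains_inf[OF K c\<Phi>] by blast
  define m where "m = \<Phi> v0 / 2"
  have m: "m > 0" using \<Phi>pos v0(1) by (simp add: m_def)
  define U where "U = {v. m < \<Phi> v}"
  define w where "w u v = \<phi> u v / max (\<Phi> v) m" for u v
  have sumw: "(\<Sum>u\<in>I. w u v) = \<Phi> v / max (\<Phi> v) m" for v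
    by (simp add: w_def \<Phi>_def sum_divide_distrib)
  define s0 where "s0 = Min ((\<lambda>u. d u / 2) ` I)"
  show thesis
  proof
    show "s0 > 0" unfolding s0_def using I \<open>I \<noteq> {}\<close> H(1) by (subst Min_gr_iff) auto
    show "open U" unfolding U_def by (intro open_Collect_less c\<Phi> continuous_on_const)
    show "K \<subseteq> U"
    proof
      fix v assume "v \<in> K"
      then show "v \<in> U" using v0(2)[of v] m by (simp add: U_def m_def)
    qed
    fix s :: real assume s: "0 < s" "s \<le> s0"
    have sd: "s \<le> d u / 2" if "u \<in> I" for u
    proof -
      have "s0 \<le> d u / 2" unfolding s0_def using that I by (intro Min_le) auto
      then show ?thesis using s by simp
    qed
    have w1: "(\<Sum>u\<in>I. w u v) \<le> 1" for v using m by (auto simp: sumw divide_le_eq_1 less_max_iff_disj)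
    have "\<exists>\<eta>. continuous_on UNIV \<eta> \<and> (\<forall>v. dist (\<eta> v) v \<le> s * (\<Sum>i\<in>I. w i v)) \<and>
     (\<forall>v. g (\<eta> v) \<le> g v - e * (s * (\<Sum>i\<in>I. w i v)))"
    proof (rule finite_descent[where d = d and z = "\<lambda>u. u" and \<H> = \<H>])
      show "continuous_on UNIV (w u)" for u unfolding w_def
        using m by (intro continuous_intros c\<phi> c\<Phi>) (auto simp: max_def)
      show "0 \<le> w u v" for u v unfolding w_def using \<phi>0 m by (intro divide_nonneg_nonneg) auto
      show "dist u v < d u / 2" if "w u v \<noteq> 0" for u v
        using that by (auto simp: w_def \<phi>_def max_def split: if_splits)
      show "dist (\<H> u (v, t)) v \<le> t" "g (\<H> u (v, t)) \<le> g v - e * t"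
        if "u \<in> I" "v \<in> ball u (d u)" "t \<in> {0..d u}" for u v t
        using H(3,4)[of u v t] that I(1) by auto
      show "continuous_on (ball u (d u) \<times> {0..d u}) (\<H> u)" if "u \<in> I" for u
        using H(2) that I(1) by auto
    qed (use I(2) s(1) sd w1 \<open>0 \<le> e\<close> in simp_all)
    then obtain \<eta> where \<eta>: "continuous_on UNIV \<eta>" "\<And>v. dist (\<eta> v) v \<le> s * (\<Sum>i\<in>I. w i v)"
     "\<And>v. g (\<eta> v) \<le> g v - e * (s * (\<Sum>i\<in>I. w i v))" by blast
    have sw: "0 \<le> (\<Sum>u\<in>I. w u v)" for v using \<Phi>0[of v] m by (simp add: sumw)
    have "dist (\<eta> v) v \<le> s" for v
      using \<eta>(2)[of v] mult_left_mono[OF w1[of v] less_imp_le[OF s(1)]] by simp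
    moreover have "g (\<eta> v) \<le> g v" for v
    proof -
      have "0 \<le> e * (s * (\<Sum>u\<in>I. w u v))" using sw[of v] s(1) \<open>0 \<le> e\<close> by simp
      then show ?thesis using \<eta>(3)[of v] by linarith
    qed
    moreover have "\<eta> v = v" if "g v \<le> b" for v
    proof -
      have "\<Phi> v = 0" using that by (simp add: \<Phi>_def \<phi>_def)
      then show ?thesis using \<eta>(2)[of v] by (simp add: sumw)
    qed
    moreover have "g (\<eta> v) \<le> g v - e * s" if "v \<in> U" for v
    proof -
      have "(\<Sum>u\<in>I. w u v) = 1" using that m by (simp add: U_def sumw)
      then show ?thesis using \<eta>(3)[of v] by simp
    qed
    ultimately show "\<exists>\<eta>. continuous_on UNIV \<eta> \<and> (\<forall>v. dist (\<eta> v) v \<le> s \<and> g (\<eta> v) \<le> g v) \<and>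
       (\<forall>v. g v \<le> b \<longrightarrow> \<eta> v = v) \<and> (\<forall>v\<in>U. g (\<eta> v) \<le> g v - e * s)"
      using \<eta>(1) by blast
  qed
qed

subsection \<open>Almost critical points at a minimax level\<close>

lemma Ekeland_variational_principle:
  fixes P :: "'a::complete_space set" and \<Psi> :: "'a \<Rightarrow> real"
  assumes "p0 \<in> P" and lsc: "\<And>a. closed {q \<in> P. \<Psi> q \<le> a}"
    and bdd: "\<And>q. q \<in> P \<Longrightarrow> l \<le> \<Psi> q" and e: "0 < e"
  obtains p where "p \<in> P" "e * dist p0 p \<le> \<Psi> p0 - \<Psi> p"
    "\<And>q. q \<in> P \<Longrightarrow> q \<noteq> p \<Longrightarrow> \<Psi> p < \<Psi> q + e * dist p q"
proof -
  define F where "F p = {q \<in> P. \<Psi> q + e * dist p q \<le> \<Psi> p}" for p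
  have F_refl: "p \<in> F p" if "p \<in> P" for p using that by (simp add: F_def)
  have F_trans: "z \<in> F x" if "y \<in> F x" "z \<in> F y" for x y z
  proof -
    have "e * dist x z \<le> e * (dist x y + dist y z)"
      using e by (intro mult_left_mono dist_triangle) auto
    then show ?thesis using that by (auto simp: F_def algebra_simps)
  qed
  have step: "\<exists>q. q \<in> F p \<and> (\<forall>z\<in>F p. \<Psi> q \<le> \<Psi> z + d)" if "p \<in> P" "0 < d" for p d
  proof -
    have ne: "\<Psi> ` F p \<noteq> {}" using F_refl[OF that(1)] by auto
    have "bdd_below (\<Psi> ` F p)" by (rule bdd_belowI[of _ l]) (use bdd in \<open>auto simp: F_def\<close>)
    then have lower: "Inf (\<Psi> ` F p) \<le> \<Psi> z" if "z \<in> F p" for z using that by (intro cInf_lower) auto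
    obtain q where "q \<in> F p" "\<Psi> q < Inf (\<Psi> ` F p) + d"
      using cInf_lessD[OF ne, of "Inf (\<Psi> ` F p) + d"] \<open>0 < d\<close> by auto
    then show ?thesis using lower by (intro exI[of _ q]) force
  qed
  have "\<exists>x. x 0 = p0 \<and> (\<forall>n. x n \<in> P \<and> (x (Suc n) \<in> F (x n) \<and>
      (\<forall>z\<in>F (x n). \<Psi> (x (Suc n)) \<le> \<Psi> z + 1 / real (Suc n))))"
  proof -
    have "\<exists>x. \<forall>n. (x n \<in> P \<and> (n = 0 \<longrightarrow> x n = p0)) \<and> (x (Suc n) \<in> F (x n) \<and>
      (\<forall>z\<in>F (x n). \<Psi> (x (Suc n)) \<le> \<Psi> z + 1 / real (Suc n)))"
    proof (rule dependent_nat_choice)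
      fix x and n :: nat assume "x \<in> P \<and> (n = 0 \<longrightarrow> x = p0)"
      then obtain q where q: "q \<in> F x" "\<forall>z\<in>F x. \<Psi> q \<le> \<Psi> z + 1 / real (Suc n)"
        using step[of x "1 / real (Suc n)"] by auto
      then show "\<exists>y. (y \<in> P \<and> (Suc n = 0 \<longrightarrow> y = p0)) \<and> y \<in> F x \<and>
          (\<forall>z\<in>F x. \<Psi> y \<le> \<Psi> z + 1 / real (Suc n))"
        by (intro exI[of _ q]) (auto simp: F_def)
    qed (use \<open>p0 \<in> P\<close> in auto)
    then show ?thesis by blast
  qed
  then obtain x where x: "x 0 = p0" "\<And>n. x n \<in> P" "\<And>n. x (Suc n) \<in> F (x n)"
    "\<And>n z. z \<in> F (x n) \<Longrightarrow> \<Psi> (x (Suc n)) \<le> \<Psi> z + 1 / real (Suc n)" by blast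
  have xF: "x m \<in> F (x n)" if "n \<le> m" for n m
    using that by (induction m rule: dec_induct) (use F_refl x F_trans in blast)+
  have "decseq (\<lambda>n. \<Psi> (x n))"
  proof (rule decseq_SucI)
    show "\<Psi> (x (Suc n)) \<le> \<Psi> (x n)" for n
    proof -
      have "0 \<le> e * dist (x n) (x (Suc n))" using e by simp
      then show ?thesis using x(3)[of n] unfolding F_def by simp
    qed
  qed
  then obtain L where L: "(\<lambda>n. \<Psi> (x n)) \<longlonglongrightarrow> L" "\<And>n. L \<le> \<Psi> (x n)"
    using decseq_convergent[of "\<lambda>n. \<Psi> (x n)" l] bdd x(2) by blast
  have dx: "e * dist (x n) (x m) \<le> \<Psi> (x n) - L" if "n \<le> m" for n m
    using xF[OF that] L(2)[of m] by (simp add: F_def)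
  have "Cauchy x"
  proof (rule metric_CauchyI)
    fix d :: real assume "0 < d"
    then have "\<forall>\<^sub>F n in sequentially. \<Psi> (x n) < L + e * (d / 2)"
      using e L(1) by (intro order_tendstoD) auto
    then obtain N where N: "\<Psi> (x N) < L + e * (d / 2)" by (auto simp: eventually_sequentially)
    have near: "dist (x N) (x m) < d / 2" if "N \<le> m" for m
    proof -
      have "e * dist (x N) (x m) < e * (d / 2)" using dx[OF that] N by linarith
      then show ?thesis using e by simp
    qed
    have "dist (x m) (x n) < d" if "N \<le> m" "N \<le> n" for m n
      using near[OF that(1)] near[OF that(2)] dist_triangle3[of "x m" "x n" "x N"] by linarith
    then show "\<exists>M. \<forall>m\<ge>M. \<forall>n\<ge>M. dist (x m) (x n) < d" by blast
  qed
  then obtain p where p: "x \<longlonglongrightarrow> p" by (auto simp: Cauchy_convergent_iff convergent_def)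
  have pF: "p \<in> F (x n)" for n
  proof -
    have le: "p \<in> P \<and> \<Psi> p \<le> \<Psi> (x n) - e * dist (x n) p + d" if "0 < d" for d
    proof -
      have "(\<lambda>m. \<Psi> (x n) - e * dist (x n) (x m)) \<longlonglongrightarrow> \<Psi> (x n) - e * dist (x n) p"
        by (intro tendsto_intros p)
      then have "\<forall>\<^sub>F m in sequentially. \<Psi> (x n) - e * dist (x n) (x m) < \<Psi> (x n) - e * dist (x n) p + d"
        using that by (intro order_tendstoD) auto
      then have "\<forall>\<^sub>F m in sequentially. x m \<in> {q \<in> P. \<Psi> q \<le> \<Psi> (x n) - e * dist (x n) p + d}"
        using eventually_ge_at_top[of n]
      proof eventually_elim
        case (elim m)
        then show ?case using xF[of n m] by (auto simp: F_def)
      qed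
      then show ?thesis using Lim_in_closed_set[OF lsc _ _ p] by force
    qed
    have "\<Psi> p \<le> \<Psi> (x n) - e * dist (x n) p" by (rule field_le_epsilon) (use le in blast)
    then show ?thesis using le[of 1] by (simp add: F_def)
  qed
  show thesis
  proof
    show "p \<in> P" "e * dist p0 p \<le> \<Psi> p0 - \<Psi> p" using pF[of 0] x(1) by (auto simp: F_def)
    show "\<Psi> p < \<Psi> q + e * dist p q" if "q \<in> P" "q \<noteq> p" for q
    proof (rule ccontr)
      assume "\<not> ?thesis"
      then have q: "q \<in> F p" using that by (simp add: F_def)
      have le: "e * dist (x (Suc n)) q \<le> 1 / real (Suc n)" for n
        using x(4)[OF F_trans[OF pF q], of n] F_trans[OF pF q, of "Suc n"] by (simp add: F_def)
      then have bound: "dist (x (Suc n)) q \<le> 1 / e * (1 / real (Suc n))" for n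
      proof -
        have "dist (x (Suc n)) q = 1 / e * (e * dist (x (Suc n)) q)" using e by simp
        also have "\<dots> \<le> 1 / e * (1 / real (Suc n))"
          using e le by (intro mult_left_mono) auto
        finally show ?thesis .
      qed
      have lim: "(\<lambda>n. 1 / e * (1 / real (Suc n))) \<longlonglongrightarrow> 0"
        using tendsto_mult[OF tendsto_const LIMSEQ_inverse_real_of_nat, of "1 / e"]
        by (simp add: inverse_eq_divide)
      have "(\<lambda>n. dist (x (Suc n)) q) \<longlonglongrightarrow> 0"
        by (rule tendsto_sandwich[OF _ _ tendsto_const lim]) (use bound in auto)
      then have "(\<lambda>n. x (Suc n)) \<longlonglongrightarrow> q" by (subst tendsto_dist_iff)
      moreover have "(\<lambda>n. x (Suc n)) \<longlonglongrightarrow> p" using p by (rule LIMSEQ_Suc)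
      ultimately show False using \<open>q \<noteq> p\<close> LIMSEQ_unique by blast
    qed
  qed
qed

lemma continuous_on_bcontfun_eval: "continuous_on A (\<lambda>p. apply_bcontfun p t)"
proof (rule continuous_on_iff[THEN iffD2], intro ballI allI impI)
  fix p :: "'a \<Rightarrow>\<^sub>C 'b" and e :: real assume "0 < e"
  then show "\<exists>d>0. \<forall>q\<in>A. dist q p < d \<longrightarrow> dist (apply_bcontfun q t) (apply_bcontfun p t) < e"
    using dist_bounded le_less_trans by (intro exI[of _ e]) blast
qed

text \<open>
  Ekeland's principle is applied to the maps that stay pointwise below \<open>\<gamma>\<close>.  Hence a point where
  the almost minimal map reaches the level \<open>c\<close> lies near a point where \<open>\<gamma>\<close> itself reaches \<open>c\<close>.
\<close>

lemma minimax_almost_critical_point: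
  fixes g :: "'x::complete_space \<Rightarrow> real" and D :: "'a::euclidean_space set"
  assumes g: "continuous_on UNIV g" and D: "compact D" "convex D" "D \<noteq> {}"
    and \<gamma>: "continuous_on D \<gamma>" and e: "0 < e" and "b < c"
    and level: "\<And>p. continuous_on D p \<Longrightarrow> (\<And>t. t \<in> D \<Longrightarrow> g (\<gamma> t) \<le> b \<Longrightarrow> p t = \<gamma> t) \<Longrightarrow>
       \<exists>t\<in>D. c \<le> g (p t)"
    and top: "\<And>t. t \<in> D \<Longrightarrow> g (\<gamma> t) \<le> c + e * r"
  obtains t u where "t \<in> D" "c \<le> g (\<gamma> t)" "dist u (\<gamma> t) \<le> r" "c \<le> g u" "g u \<le> c + e * r"
    "weak_slope g u \<le> ennreal e"
proof -
  define \<rho> where "\<rho> = closest_point D"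
  have \<rho>: "continuous_on UNIV \<rho>" "\<And>t. \<rho> t \<in> D" "\<And>t. t \<in> D \<Longrightarrow> \<rho> t = t"
    using D by (auto simp: \<rho>_def compact_imp_closed closest_point_self
        intro: continuous_on_closest_point closest_point_in_set)
  have cg: "continuous_on A g" for A using g by (rule continuous_on_subset) auto
  have extend: "\<exists>q. apply_bcontfun q = h \<circ> \<rho>" if "continuous_on D h" for h :: "'a \<Rightarrow> 'x"
  proof -
    have "continuous_on UNIV (h \<circ> \<rho>)"
      using \<rho> that by (intro continuous_on_compose) (auto intro: continuous_on_subset)
    moreover have "bounded (range (h \<circ> \<rho>))"
      using compact_imp_bounded[OF compact_continuous_image[OF that D(1)]] 
      by (rule bounded_subset) (use \<rho>(2) in auto)
    ultimately have "h \<circ> \<rho> \<in> bcontfun" by (simp add: bcontfun_def)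
    then show ?thesis by (metis bcontfunE)
  qed
  define P where "P = {p. (\<forall>t. apply_bcontfun p t = apply_bcontfun p (\<rho> t)) \<and>
     (\<forall>t\<in>{t\<in>D. g (\<gamma> t) \<le> b}. apply_bcontfun p t = \<gamma> t) \<and> (\<forall>t\<in>D. g (apply_bcontfun p t) \<le> g (\<gamma> t))}"
  define \<Psi> where "\<Psi> p = (SUP t\<in>D. g (apply_bcontfun p t))" for p :: "'a \<Rightarrow>\<^sub>C 'x"
  have cgp: "continuous_on D (\<lambda>t. g (apply_bcontfun p t))" for p :: "'a \<Rightarrow>\<^sub>C 'x"
    by (rule continuous_on_compose2[OF g]) auto
  have bdd: "bdd_above ((\<lambda>t. g (apply_bcontfun p t)) ` D)" for p
    by (intro bounded_imp_bdd_above compact_imp_bounded compact_continuous_image cgp D(1))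
  have \<Psi>_le: "\<Psi> p \<le> a \<longleftrightarrow> (\<forall>t\<in>D. g (apply_bcontfun p t) \<le> a)" for p a
    unfolding \<Psi>_def by (rule cSUP_le_iff[OF D(3) bdd])
  have \<Psi>_ge: "g (apply_bcontfun p t) \<le> \<Psi> p" if "t \<in> D" for p t
    using \<Psi>_le[of p "\<Psi> p"] that by auto
  have P_level: "c \<le> \<Psi> p" if "p \<in> P" for p
  proof -
    obtain t where "t \<in> D" "c \<le> g (apply_bcontfun p t)"
      using level[of "apply_bcontfun p"] \<open>p \<in> P\<close> unfolding P_def by fastforce
    then show ?thesis using \<Psi>_ge order_trans by blast
  qed
  have ev: "continuous_on UNIV (\<lambda>p::'a \<Rightarrow>\<^sub>C 'x. apply_bcontfun p t)" for t
    by (rule continuous_on_bcontfun_eval)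
  have gev: "continuous_on UNIV (\<lambda>p::'a \<Rightarrow>\<^sub>C 'x. g (apply_bcontfun p t))" for t
    by (rule continuous_on_compose2[OF g ev]) auto
  have closed: "closed {q \<in> P. \<Psi> q \<le> a}" for a
    unfolding P_def \<Psi>_le mem_Collect_eq Ball_def
    by (intro closed_Collect_conj closed_Collect_all closed_Collect_imp open_Collect_const
          closed_Collect_eq closed_Collect_le ev gev continuous_on_const)
  obtain p0 where p0: "apply_bcontfun p0 = \<gamma> \<circ> \<rho>" using extend[OF \<gamma>] by blast
  have "p0 \<in> P" using \<rho> by (auto simp: P_def p0)
  then obtain p where p: "p \<in> P" "e * dist p0 p \<le> \<Psi> p0 - \<Psi> p"
    "\<And>q. q \<in> P \<Longrightarrow> q \<noteq> p \<Longrightarrow> \<Psi> p < \<Psi> q + e * dist p q"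
    using Ekeland_variational_principle[of p0 P \<Psi> c e, OF _ closed P_level e] by blast
  have \<Psi>0: "\<Psi> p0 \<le> c + e * r" using top \<rho> by (auto simp: \<Psi>_le p0)
  have "e * dist p0 p \<le> e * r" using p(2) \<Psi>0 P_level[OF p(1)] by linarith
  then have r: "dist p0 p \<le> r" using e by simp
  have "0 \<le> e * dist p0 p" using e by simp
  then have \<Psi>p: "\<Psi> p \<le> c + e * r" using p(2) \<Psi>0 by linarith
  let ?p = "apply_bcontfun p"
  obtain t0 where t0: "t0 \<in> D" "\<And>t. t \<in> D \<Longrightarrow> g (?p t) \<le> g (?p t0)"
    using continuous_attains_sup[OF D(1,3) cgp] by blast
  have \<Psi>t0: "g (?p t0) = \<Psi> p" using t0 \<Psi>_ge[OF t0(1)] by (intro antisym) (auto simp: \<Psi>_le)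
  define K where "K = ?p ` {t\<in>D. \<Psi> p \<le> g (?p t)}"
  have "\<exists>u\<in>K. weak_slope g u \<le> ennreal e"
  proof (rule ccontr)
    assume "\<not> ?thesis"
    then have slope: "\<And>v. v \<in> K \<Longrightarrow> ennreal e < weak_slope g v" by force
    have "compact {t\<in>D. \<Psi> p \<le> g (?p t)}"
    proof -
      have "closedin (top_of_set D) (D \<inter> (\<lambda>t. g (?p t)) -` {\<Psi> p..})"
        by (intro continuous_closedin_preimage cgp closed_atLeast)
      then show ?thesis using closedin_compact[OF D(1)] by (simp add: vimage_def Int_def)
    qed
    then have K: "compact K" unfolding K_def
      by (intro compact_continuous_image) auto
    have "K \<noteq> {}" using t0(1) \<Psi>t0 by (auto simp: K_def)
    have Kb: "b < g v" if "v \<in> K" for v using that P_level[OF p(1)] \<open>b < c\<close> by (auto simp: K_def)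
    obtain s0 U where U: "s0 > 0" "open U" "K \<subseteq> U"
      and desc: "\<And>s. 0 < s \<Longrightarrow> s \<le> s0 \<Longrightarrow> \<exists>\<eta>. continuous_on UNIV \<eta> \<and>
        (\<forall>v. dist (\<eta> v) v \<le> s \<and> g (\<eta> v) \<le> g v) \<and>
        (\<forall>v. g v \<le> b \<longrightarrow> \<eta> v = v) \<and> (\<forall>v\<in>U. g (\<eta> v) \<le> g v - e * s)"
      using local_descent[OF g K \<open>K \<noteq> {}\<close> less_imp_le[OF e] slope Kb] by blast
    have "\<exists>\<kappa>>0. \<forall>t\<in>D. ?p t \<notin> U \<longrightarrow> g (?p t) \<le> \<Psi> p - \<kappa>"
    proof (cases "{t\<in>D. ?p t \<notin> U} = {}")
      case True
      then show ?thesis by (intro exI[of _ 1]) auto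
    next
      case False
      have "compact {t\<in>D. ?p t \<notin> U}"
      proof -
        have "closedin (top_of_set D) (D \<inter> ?p -` (- U))"
          using U(2) by (intro continuous_closedin_preimage) auto
        then show ?thesis using closedin_compact[OF D(1)] by (simp add: vimage_def Int_def)
      qed
      then obtain t1 where t1': "t1 \<in> {t\<in>D. ?p t \<notin> U}"
        and max: "\<forall>t\<in>{t\<in>D. ?p t \<notin> U}. g (?p t) \<le> g (?p t1)"
        using continuous_attains_sup[OF _ False continuous_on_subset[OF cgp]] by blast
      then have t1: "t1 \<in> D" "?p t1 \<notin> U" "\<And>t. t \<in> D \<Longrightarrow> ?p t \<notin> U \<Longrightarrow> g (?p t) \<le> g (?p t1)"
        by auto
      have "?p t1 \<notin> K" using t1(2) U(3) by blast
      then have "g (?p t1) < \<Psi> p" using t1(1) by (auto simp: K_def)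
      then show ?thesis using t1(3) by (intro exI[of _ "\<Psi> p - g (?p t1)"]) auto
    qed
    then obtain \<kappa> where \<kappa>: "\<kappa> > 0" "\<And>t. t \<in> D \<Longrightarrow> ?p t \<notin> U \<Longrightarrow> g (?p t) \<le> \<Psi> p - \<kappa>" by blast
    define s where "s = min s0 (\<kappa> / e)"
    have s: "0 < s" "s \<le> s0" using U(1) \<kappa>(1) e by (auto simp: s_def)
    have "s \<le> \<kappa> / e" by (simp add: s_def)
    then have "e * s \<le> \<kappa>" using e by (simp add: field_simps)
    obtain \<eta> where \<eta>: "continuous_on UNIV \<eta>" "\<And>v. dist (\<eta> v) v \<le> s" "\<And>v. g (\<eta> v) \<le> g v"
      "\<And>v. g v \<le> b \<Longrightarrow> \<eta> v = v" "\<And>v. v \<in> U \<Longrightarrow> g (\<eta> v) \<le> g v - e * s" using desc[OF s] by blast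
    have "continuous_on D (\<eta> \<circ> ?p)" by (intro continuous_on_compose continuous_on_subset[OF \<eta>(1)]) auto
    then obtain q where q0: "apply_bcontfun q = (\<eta> \<circ> ?p) \<circ> \<rho>" using extend by blast
    have p\<rho>: "?p (\<rho> t) = ?p t" for t using p(1) by (simp add: P_def)
    have q: "apply_bcontfun q t = \<eta> (?p t)" for t by (simp add: q0 p\<rho>)
    have "q \<in> P"
      unfolding P_def
    proof (intro CollectI conjI allI ballI)
      show "apply_bcontfun q t = apply_bcontfun q (\<rho> t)" for t by (simp add: q p\<rho>)
      show "apply_bcontfun q t = \<gamma> t" if "t \<in> {t \<in> D. g (\<gamma> t) \<le> b}" for t
        using that p(1) \<eta>(4)[of "\<gamma> t"] by (simp add: q P_def)
      show "g (apply_bcontfun q t) \<le> g (\<gamma> t)" if "t \<in> D" for t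
        using that p(1) \<eta>(3)[of "?p t"] by (auto simp: q P_def intro: order_trans)
    qed
    have \<Psi>q: "\<Psi> q \<le> \<Psi> p - e * s"
      unfolding \<Psi>_le
    proof
      fix t assume t: "t \<in> D"
      show "g (apply_bcontfun q t) \<le> \<Psi> p - e * s"
      proof (cases "?p t \<in> U")
        case True
        then show ?thesis using \<eta>(5)[of "?p t"] \<Psi>_ge[OF t, of p] by (simp add: q)
      next
        case False
        then show ?thesis using \<eta>(3)[of "?p t"] \<kappa>(2)[OF t] \<open>e * s \<le> \<kappa>\<close> by (simp add: q)
      qed
    qed
    moreover have "0 < e * s" using e s(1) by simp
    ultimately have "\<Psi> q < \<Psi> p" by linarith
    then have "q \<noteq> p" by auto
    have "dist p q \<le> s" by (rule dist_bound) (metis q \<eta>(2) dist_commute)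
    then have "e * dist p q \<le> e * s" using e by simp
    then show False using p(3)[OF \<open>q \<in> P\<close> \<open>q \<noteq> p\<close>] \<Psi>q by linarith
  qed
  then obtain t where t: "t \<in> D" "\<Psi> p \<le> g (?p t)" "weak_slope g (?p t) \<le> ennreal e"
    by (auto simp: K_def)
  show thesis
  proof
    show "t \<in> D" "weak_slope g (?p t) \<le> ennreal e" by fact+
    show "c \<le> g (?p t)" using P_level[OF p(1)] t(2) by linarith
    moreover have "g (?p t) \<le> g (\<gamma> t)" using p(1) t(1) by (simp add: P_def)
    ultimately show "c \<le> g (\<gamma> t)" by linarith
    show "g (?p t) \<le> c + e * r" using \<Psi>_ge[OF t(1), of p] \<Psi>p by linarith
    have "dist (apply_bcontfun p0 t) (?p t) \<le> dist p0 p" by (rule dist_bounded)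
    then show "dist (?p t) (\<gamma> t) \<le> r" using r \<rho>(3)[OF t(1)] by (simp add: p0 dist_commute)
  qed
qed

subsection \<open>Polarization of maps\<close>

context symmetrization_framework
begin

lemma iterated_polarization_in: "u \<in> S \<Longrightarrow> iterated_polarization pol H m u \<in> S"
  by (induction m) (auto intro: pol_in)

lemma star_iterated_polarization: "u \<in> S \<Longrightarrow> star (iterated_polarization pol H m u) = star u"
  by (induction m) (auto simp: star_pol iterated_polarization_in)

lemma iterated_polarization_nonexpansive:
  assumes "u \<in> S" "v \<in> S"
  shows "norm (j (iterated_polarization pol H m u) - j (iterated_polarization pol H m v))
    \<le> norm (j u - j v)"
proof (induction m)
  case (Suc m)
  show ?case unfolding iterated_polarization.simps
    by (rule order_trans[OF pol_nonexpansive Suc.IH]) (intro iterated_polarization_in assms)+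
qed simp

lemma star_nonexpansive:
  assumes "u \<in> S" "v \<in> S"
  shows "norm (j (star u) - j (star v)) \<le> norm (j u - j v)"
proof -
  obtain H where H: "\<forall>u\<in>S. (\<lambda>m. j (iterated_polarization pol H m u)) \<longlonglongrightarrow> j (star u)"
    using iterated_polarization_converges by blast
  have "(\<lambda>m. norm (j (iterated_polarization pol H m u) - j (iterated_polarization pol H m v)))
      \<longlonglongrightarrow> norm (j (star u) - j (star v))"
    using H assms by (intro tendsto_intros) auto
  then show ?thesis
    by (rule LIMSEQ_le_const2) (use iterated_polarization_nonexpansive[OF assms] in blast)
qed

lemma extended_star_lipschitz:
  obtains L where "0 \<le> L"
    "\<And>u v. norm (j (extended_star star \<Theta> u) - j (extended_star star \<Theta> v)) \<le> L * norm (j u - j v)"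
proof -
  obtain L where L: "\<And>u v. norm (j (\<Theta> u) - j (\<Theta> v)) \<le> L * norm (j u - j v)"
    using Theta_lipschitz by blast
  show thesis
  proof
    show "0 \<le> \<bar>L\<bar>" by simp
    fix u v
    have "norm (j (extended_star star \<Theta> u) - j (extended_star star \<Theta> v)) \<le> norm (j (\<Theta> u) - j (\<Theta> v))"
      unfolding extended_star_def by (intro star_nonexpansive Theta_in)
    also have "\<dots> \<le> L * norm (j u - j v)" by (rule L)
    also have "\<dots> \<le> \<bar>L\<bar> * norm (j u - j v)" by (intro mult_right_mono) auto
    finally show "norm (j (extended_star star \<Theta> u) - j (extended_star star \<Theta> v)) \<le> \<bar>L\<bar> * norm (j u - j v)" .
  qed
qed

lemma iterated_polarization_uniform:
  assumes H: "\<forall>u\<in>S. (\<lambda>m. j (iterated_polarization pol H m u)) \<longlonglongrightarrow> j (star u)"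
    and K: "compact K" "K \<subseteq> S" and e: "0 < e"
  obtains m where "\<And>u. u \<in> K \<Longrightarrow> norm (j (iterated_polarization pol H m u) - j (star u)) < e"
proof -
  have cj: "continuous_on UNIV j" using embedding_bounded_linear by (rule linear_continuous_on)
  have "open {u. dist (j v) (j u) < e / 3}" for v
    by (intro open_Collect_less continuous_intros cj)
  then obtain T where T: "T \<subseteq> K" "finite T" "K \<subseteq> (\<Union>v\<in>T. {u. dist (j v) (j u) < e / 3})"
    using compactE_image[OF K(1), of K "\<lambda>v. {u. dist (j v) (j u) < e / 3}"] e by force
  have "\<forall>\<^sub>F m in sequentially. \<forall>v\<in>T. dist (j (iterated_polarization pol H m v)) (j (star v)) < e / 3"
  proof (intro eventually_ball_finite ballI T(2))
    fix v assume "v \<in> T"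
    then have "(\<lambda>m. j (iterated_polarization pol H m v)) \<longlonglongrightarrow> j (star v)" using H T(1) K(2) by auto
    then show "\<forall>\<^sub>F m in sequentially. dist (j (iterated_polarization pol H m v)) (j (star v)) < e / 3"
      using e by (intro tendstoD) auto
  qed
  then obtain m where m: "\<forall>v\<in>T. dist (j (iterated_polarization pol H m v)) (j (star v)) < e / 3"
    by (auto simp: eventually_sequentially)
  show thesis
  proof
    fix u assume u: "u \<in> K"
    then obtain v where v: "v \<in> T" "norm (j u - j v) < e / 3"
      using T(3) by (auto simp: dist_norm norm_minus_commute)
    have uv: "u \<in> S" "v \<in> S" using u v T K by auto
    have "norm (j (iterated_polarization pol H m u) - j (star u)) =
      norm ((j (iterated_polarization pol H m u) - j (iterated_polarization pol H m v)) +
        (j (iterated_polarization pol H m v) - j (star v)) + (j (star v) - j (star u)))" by simp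
    also have "\<dots> \<le> norm (j u - j v) + norm (j (iterated_polarization pol H m v) - j (star v))
        + norm (j u - j v)"
      using iterated_polarization_nonexpansive[OF uv, of H m] star_nonexpansive[OF uv]
      by (intro norm_triangle_mono) (auto simp: norm_minus_commute)
    also have "\<dots> < e" using v m by (force simp: dist_norm)
    finally show "norm (j (iterated_polarization pol H m u) - j (star u)) < e" .
  qed
qed

lemma homotopic_polarization:
  assumes \<phi>: "\<And>\<phi> u H. \<phi> \<in> \<Phi> \<Longrightarrow> u \<in> S \<Longrightarrow> \<phi> (pol u H) \<le> (\<phi> u :: real)"
    and q: "continuous_on S q" "q \<in> S \<rightarrow> S" "\<forall>u\<in>S. \<forall>\<phi>\<in>\<Phi>. \<phi> (q u) \<le> \<phi> u"
  shows "homotopic_with_canon (\<lambda>k. \<forall>u\<in>S. \<forall>\<phi>\<in>\<Phi>. \<phi> (k u) \<le> \<phi> u) S S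
      (\<lambda>u. pol (q u) H) (\<lambda>u. pol (q u) H')"
proof -
  obtain \<sigma> where \<sigma>: "path \<sigma>" "pathstart \<sigma> = H" "pathfinish \<sigma> = H'"
    using path_connected_polarizers unfolding path_connected_def by blast
  have "continuous_on ({0..1} \<times> S) (\<lambda>z. q (snd z))"
    by (rule continuous_on_compose2[OF q(1)]) (auto intro: continuous_on_snd)
  moreover have "continuous_on ({0..1} \<times> S) (\<lambda>z. \<sigma> (fst z))"
    by (rule continuous_on_compose2[OF \<sigma>(1)[unfolded path_def]]) (auto intro: continuous_on_fst)
  ultimately have "continuous_on ({0..1} \<times> S) (\<lambda>z. (q (snd z), \<sigma> (fst z)))"
    by (rule continuous_on_Pair)
  then have "continuous_on ({0..1} \<times> S) (\<lambda>z. (\<lambda>(u, H). pol u H) (q (snd z), \<sigma> (fst z)))"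
    by (rule continuous_on_compose2[OF pol_continuous]) (use q(2) in auto)
  then have cont: "continuous_on ({0..1} \<times> S) (\<lambda>z. pol (q (snd z)) (\<sigma> (fst z)))" by simp
  show ?thesis
  proof (subst homotopic_with)
    show "\<exists>h. continuous_map (prod_topology (subtopology euclideanreal {0..1}) (top_of_set S)) (top_of_set S) h \<and>
        (\<forall>x\<in>topspace (top_of_set S). h (0, x) = pol (q x) H) \<and>
        (\<forall>x\<in>topspace (top_of_set S). h (1, x) = pol (q x) H') \<and>
        (\<forall>t\<in>{0..1}. \<forall>u\<in>S. \<forall>\<phi>\<in>\<Phi>. \<phi> (h (t, u)) \<le> \<phi> u)"
    proof (intro exI[of _ "\<lambda>z. pol (q (snd z)) (\<sigma> (fst z))"] conjI ballI)
      show "continuous_map (prod_topology (subtopology euclideanreal {0..1}) (top_of_set S)) (top_of_set S)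
          (\<lambda>z. pol (q (snd z)) (\<sigma> (fst z)))"
        using cont q(2) pol_in by (auto simp: Pi_iff)
      show "\<phi> (pol (q (snd (t, u))) (\<sigma> (fst (t, u)))) \<le> \<phi> u" if "u \<in> S" "\<phi> \<in> \<Phi>" for t u \<phi>
        using \<phi>[of \<phi> "q u" "\<sigma> t"] q that by (auto intro: order_trans)
    qed (use \<sigma> in \<open>auto simp: pathstart_def pathfinish_def\<close>)
  qed auto
qed

text \<open>
  Polarizing twice by the same polarizer changes nothing, so a path from the last polarizer used
  to the next one starts a new homotopy exactly where the previous one ended.
\<close>

lemma homotopic_iterated_polarization:
  assumes \<phi>: "\<And>\<phi> u H. \<phi> \<in> \<Phi> \<Longrightarrow> u \<in> S \<Longrightarrow> \<phi> (pol u H) \<le> (\<phi> u :: real)"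
  shows "homotopic_with_canon (\<lambda>k. \<forall>u\<in>S. \<forall>\<phi>\<in>\<Phi>. \<phi> (k u) \<le> \<phi> u) S S
      (\<lambda>u. pol u H0) (\<lambda>u. iterated_polarization pol H m (pol u H0))"
proof (induction m)
  case 0
  have "homotopic_with_canon (\<lambda>k. \<forall>u\<in>S. \<forall>\<phi>\<in>\<Phi>. \<phi> (k u) \<le> \<phi> u) S S
      (\<lambda>u. pol u H0) (\<lambda>u. pol u H0)"
    by (rule homotopic_polarization[of \<Phi> "\<lambda>u. u", OF \<phi>]) auto
  then show ?case by simp
next
  case (Suc m)
  let ?q = "\<lambda>u. iterated_polarization pol H m (pol u H0)"
  define H' where "H' = (case m of 0 \<Rightarrow> H0 | Suc k \<Rightarrow> H k)"
  have fixed: "pol (?q u) H' = ?q u" if "u \<in> S" for u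
    using that by (cases m) (auto simp: H'_def pol_idem pol_in iterated_polarization_in)
  have q: "continuous_on S ?q" "?q \<in> S \<rightarrow> S" "\<forall>u\<in>S. \<forall>\<phi>\<in>\<Phi>. \<phi> (?q u) \<le> \<phi> u"
    using homotopic_with_imp_continuous[OF Suc.IH] homotopic_with_imp_funspace1[OF Suc.IH]
      homotopic_with_imp_property[OF Suc.IH]
    by (auto intro: iterated_polarization_in pol_in)
  have "homotopic_with_canon (\<lambda>k. \<forall>u\<in>S. \<forall>\<phi>\<in>\<Phi>. \<phi> (k u) \<le> \<phi> u) S S
      (\<lambda>u. pol (?q u) H') (\<lambda>u. pol (?q u) (H m))"
    by (rule homotopic_polarization[OF \<phi> q])
  then have "homotopic_with_canon (\<lambda>k. \<forall>u\<in>S. \<forall>\<phi>\<in>\<Phi>. \<phi> (k u) \<le> \<phi> u) S S ?q (\<lambda>u. pol (?q u) (H m))"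
    by (rule homotopic_with_eq) (auto simp: fixed)
  with Suc.IH show ?case unfolding iterated_polarization.simps by (rule homotopic_with_trans)
qed

lemma polarized_map:
  fixes \<gamma> :: "'a::euclidean_space \<Rightarrow> 'x"
  assumes \<phi>: "\<And>\<phi> u H. \<phi> \<in> \<Phi> \<Longrightarrow> u \<in> S \<Longrightarrow> \<phi> (pol u H) \<le> (\<phi> u :: real)"
    and \<gamma>: "continuous_on (cball 0 1) \<gamma>" "\<gamma> ` cball 0 1 \<subseteq> S" and "r < 1" "0 < e"
  obtains p where "continuous_on (cball 0 1) p" "p ` cball 0 1 \<subseteq> S"
    "\<And>t. t \<in> sphere 0 1 \<Longrightarrow> p t = pol (\<gamma> t) H0"
    "\<And>t \<phi>. t \<in> cball 0 1 \<Longrightarrow> \<phi> \<in> \<Phi> \<Longrightarrow> \<phi> (p t) \<le> \<phi> (\<gamma> t)"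
    "\<And>t. t \<in> cball 0 1 \<Longrightarrow> norm t \<le> r \<Longrightarrow> norm (j (p t) - j (star (p t))) < e"
proof -
  obtain H where H: "\<forall>u\<in>S. (\<lambda>m. j (iterated_polarization pol H m u)) \<longlonglongrightarrow> j (star u)"
    using iterated_polarization_converges by blast
  have "continuous_on (cball 0 1) (\<lambda>t. (\<lambda>(u, H). pol u H) (\<gamma> t, H0))"
    by (rule continuous_on_compose2[OF pol_continuous]) (use \<gamma> in \<open>auto intro!: continuous_intros\<close>)
  then have "compact ((\<lambda>t. pol (\<gamma> t) H0) ` cball 0 1)" by (intro compact_continuous_image) auto
  moreover have "(\<lambda>t. pol (\<gamma> t) H0) ` cball 0 1 \<subseteq> S" using \<gamma>(2) pol_in by auto
  ultimately obtain m where m: "\<And>u. u \<in> (\<lambda>t. pol (\<gamma> t) H0) ` cball 0 1 \<Longrightarrow>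
      norm (j (iterated_polarization pol H m u) - j (star u)) < e"
    using iterated_polarization_uniform[OF H _ _ \<open>0 < e\<close>] by blast
  obtain h where h: "continuous_on ({0..1::real} \<times> S) h" "h \<in> ({0..1} \<times> S) \<rightarrow> S"
    "\<And>u. u \<in> S \<Longrightarrow> h (0, u) = pol u H0"
    "\<And>u. u \<in> S \<Longrightarrow> h (1, u) = iterated_polarization pol H m (pol u H0)"
    "\<And>s u \<phi>. s \<in> {0..1} \<Longrightarrow> u \<in> S \<Longrightarrow> \<phi> \<in> \<Phi> \<Longrightarrow> \<phi> (h (s, u)) \<le> \<phi> u"
    using homotopic_iterated_polarization[of \<Phi> H0 H m, OF \<phi>]
    unfolding homotopic_with_def by (simp del: atLeastAtMost_iff) blast
  define \<psi> where "\<psi> t = max 0 (min 1 ((1 - norm t) / (1 - r)))" for t :: 'a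
  have \<psi>: "\<psi> t \<in> {0..1}" for t by (auto simp: \<psi>_def)
  have c\<psi>: "continuous_on A \<psi>" for A unfolding \<psi>_def
    using \<open>r < 1\<close> by (intro continuous_intros) auto
  define p where "p t = h (\<psi> t, \<gamma> t)" for t
  show thesis
  proof
    show "continuous_on (cball 0 1) p" unfolding p_def
      by (rule continuous_on_compose2[OF h(1)]) (use \<gamma> \<psi> c\<psi> in \<open>auto intro!: continuous_on_Pair\<close>)
    show "p ` cball 0 1 \<subseteq> S" using funcset_mem[OF h(2)] \<psi> \<gamma>(2) unfolding p_def by blast
    show "p t = pol (\<gamma> t) H0" if "t \<in> sphere 0 1" for t
    proof -
      have "\<psi> t = 0" using that by (simp add: \<psi>_def)
      moreover have "\<gamma> t \<in> S" using that \<gamma>(2) by auto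
      ultimately show ?thesis using h(3) by (simp add: p_def)
    qed
    show "\<phi> (p t) \<le> \<phi> (\<gamma> t)" if "t \<in> cball 0 1" "\<phi> \<in> \<Phi>" for t \<phi>
      unfolding p_def by (rule h(5)) (use that \<gamma>(2) \<psi> in auto)
    show "norm (j (p t) - j (star (p t))) < e" if t: "t \<in> cball 0 1" "norm t \<le> r" for t
    proof -
      have "\<psi> t = 1" using t(2) \<open>r < 1\<close> by (simp add: \<psi>_def le_divide_eq)
      moreover have "\<gamma> t \<in> S" using t \<gamma>(2) by auto
      ultimately have "p t = iterated_polarization pol H m (pol (\<gamma> t) H0)" "pol (\<gamma> t) H0 \<in> S"
        using h(4) pol_in by (auto simp: p_def)
      then show ?thesis using m[of "pol (\<gamma> t) H0"] t(1) by (auto simp: star_iterated_polarization)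
    qed
  qed
qed

lemma almost_symmetric_almost_critical_point:
  fixes \<Gamma>0 :: "((real ^ 'm) \<Rightarrow> 'x) set" and g k :: "'x \<Rightarrow> real"
  assumes g: "continuous_on UNIV g"
    and level: "\<And>p. p \<in> minimax_class \<Gamma>0 \<Longrightarrow> \<exists>t\<in>cball 0 1. c \<le> g (p t)"
    and boundary: "\<And>p \<tau>. p \<in> minimax_class \<Gamma>0 \<Longrightarrow> \<tau> \<in> sphere 0 1 \<Longrightarrow> g (p \<tau>) < b" and "b < c"
    and pol: "\<And>u H. u \<in> S \<Longrightarrow> g (pol u H) \<le> g u" "\<And>u H. u \<in> S \<Longrightarrow> k (pol u H) \<le> k u"
    and \<gamma>: "\<gamma> \<in> minimax_class \<Gamma>0" "\<gamma> ` cball 0 1 \<subseteq> S" "(\<lambda>\<tau>\<in>sphere 0 1. pol (\<gamma> \<tau>) H0) \<in> \<Gamma>0"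
    and k: "\<And>t. t \<in> cball 0 1 \<Longrightarrow> k (\<gamma> t) \<le> a"
    and e: "0 < e" "0 < r" "0 < d"
    and control: "\<And>v. k v \<le> a \<Longrightarrow> c \<le> g v \<Longrightarrow> norm v \<le> M \<and> g v \<le> c + e * r"
  obtains u v where "dist u v \<le> r" "v \<in> S" "norm v \<le> M" "norm (j v - j (star v)) < d"
    "c \<le> g u" "g u \<le> c + e * r" "weak_slope g u \<le> ennreal e"
proof -
  have c\<gamma>: "continuous_on (cball 0 1) \<gamma>" using \<gamma>(1) by (simp add: minimax_class_def continuous_maps_def)
  have cg\<gamma>: "continuous_on (cball 0 1) (\<lambda>t. g (\<gamma> t))"
    by (rule continuous_on_compose2[OF g c\<gamma>]) auto
  have "\<exists>r0<1. \<forall>t\<in>cball 0 1. b \<le> g (\<gamma> t) \<longrightarrow> norm t \<le> r0"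
  proof (cases "{t\<in>cball 0 1. b \<le> g (\<gamma> t)} = {}")
    case True
    then show ?thesis by (intro exI[of _ 0]) auto
  next
    case False
    have "closedin (top_of_set (cball 0 1)) (cball 0 1 \<inter> (\<lambda>t. g (\<gamma> t)) -` {b..})"
      by (intro continuous_closedin_preimage cg\<gamma> closed_atLeast)
    then have "compact {t\<in>cball 0 1. b \<le> g (\<gamma> t)}"
      using closedin_compact[OF compact_cball] by (simp add: vimage_def Int_def)
    then obtain t1 where t1: "t1 \<in> {t\<in>cball 0 1. b \<le> g (\<gamma> t)}"
      "\<forall>t\<in>{t\<in>cball 0 1. b \<le> g (\<gamma> t)}. norm t \<le> norm t1"
      using continuous_attains_sup[OF _ False continuous_on_norm_id] by blast
    then have "norm t1 \<noteq> 1" using boundary[OF \<gamma>(1), of t1] by auto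
    then have "norm t1 < 1" using t1(1) by simp
    then show ?thesis using t1(2) by (intro exI[of _ "norm t1"]) auto
  qed
  then obtain r0 where r0: "r0 < 1" "\<And>t. t \<in> cball 0 1 \<Longrightarrow> b \<le> g (\<gamma> t) \<Longrightarrow> norm t \<le> r0" by blast
  obtain p where p: "continuous_on (cball 0 1) p" "p ` cball 0 1 \<subseteq> S"
    "\<And>t. t \<in> sphere 0 1 \<Longrightarrow> p t = pol (\<gamma> t) H0"
    "\<And>t \<phi>. t \<in> cball 0 1 \<Longrightarrow> \<phi> \<in> {g, k} \<Longrightarrow> \<phi> (p t) \<le> \<phi> (\<gamma> t)"
    "\<And>t. t \<in> cball 0 1 \<Longrightarrow> norm t \<le> r0 \<Longrightarrow> norm (j (p t) - j (star (p t))) < d"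
    by (rule polarized_map[of "{g, k}" \<gamma> r0 d H0]) (use pol c\<gamma> \<gamma>(2) r0(1) e in auto)
  have in_class: "restrict q (cball 0 1) \<in> minimax_class \<Gamma>0"
    if q: "continuous_on (cball 0 1) q" "\<And>\<tau>. \<tau> \<in> sphere 0 1 \<Longrightarrow> q \<tau> = p \<tau>" for q
  proof -
    have "restrict (restrict q (cball 0 1)) (sphere 0 1) = (\<lambda>\<tau>\<in>sphere 0 1. pol (\<gamma> \<tau>) H0)"
      using q(2) p(3) by (auto simp: restrict_def)
    moreover have "continuous_on (cball 0 1) (restrict q (cball 0 1))"
      using q(1) by (rule continuous_on_eq) simp
    ultimately show ?thesis using \<gamma>(3) by (simp add: minimax_class_def continuous_maps_def)
  qed
  have pb: "g (p \<tau>) < b" if "\<tau> \<in> sphere 0 1" for \<tau>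
    using boundary[OF in_class[OF p(1)] that] that by simp
  have kp: "k (p t) \<le> a" if "t \<in> cball 0 1" for t using p(4)[OF that, of k] k[OF that] by simp
  obtain t u where tu: "t \<in> cball 0 1" "c \<le> g (p t)" "dist u (p t) \<le> r" "c \<le> g u" "g u \<le> c + e * r"
    "weak_slope g u \<le> ennreal e"
  proof (rule minimax_almost_critical_point[OF g compact_cball convex_cball _ p(1) e(1) \<open>b < c\<close>])
    show "\<exists>t\<in>cball 0 1. c \<le> g (q t)" if "continuous_on (cball 0 1) q"
      "\<And>t. t \<in> cball 0 1 \<Longrightarrow> g (p t) \<le> b \<Longrightarrow> q t = p t" for q
      using level[OF in_class[OF that(1)]] that(2) pb by fastforce
    show "g (p t) \<le> c + e * r" if "t \<in> cball 0 1" for t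
    proof (cases "c \<le> g (p t)")
      case True
      then show ?thesis using control[OF kp[OF that]] by simp
    next
      case False
      have "0 < e * r" using e by simp
      then show ?thesis using False by linarith
    qed
  qed auto
  have "b \<le> g (\<gamma> t)" using tu(2) p(4)[OF tu(1), of g] \<open>b < c\<close> by simp
  then have "norm (j (p t) - j (star (p t))) < d" using p(5) r0(2) tu(1) by blast
  moreover have "norm (p t) \<le> M" using control[OF kp[OF tu(1)] tu(2)] by simp
  ultimately show thesis using that[OF tu(3)] p(2) tu by blast
qed

end

subsection \<open>The monotonicity trick\<close>

lemma minimax_level_le_value:
  fixes f :: "real \<Rightarrow> 'x::topological_space \<Rightarrow> real" and \<Gamma>0 :: "((real ^ 'm) \<Rightarrow> 'x) set"
  assumes f: "continuous_on UNIV (f l)" and p: "p \<in> minimax_class \<Gamma>0"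
    and c: "minimax_level f \<Gamma>0 l = ereal c"
  shows "\<exists>t\<in>cball 0 1. c \<le> f l (p t)"
proof -
  have "continuous_on (cball 0 1) (\<lambda>t. f l (p t))"
    by (rule continuous_on_compose2[OF f]) (use p in \<open>auto simp: minimax_class_def continuous_maps_def\<close>)
  then obtain t where t: "t \<in> cball 0 1" "\<And>s. s \<in> cball 0 1 \<Longrightarrow> f l (p s) \<le> f l (p t)"
    using continuous_attains_sup[of "cball 0 1 :: (real ^ 'm) set" "\<lambda>t. f l (p t)"] by auto
  have "ereal c \<le> (SUP t\<in>cball 0 1. ereal (f l (p t)))"
    unfolding c[symmetric] minimax_level_def by (rule INF_lower[OF p])
  also have "\<dots> \<le> ereal (f l (p t))" by (rule SUP_least) (use t in auto)
  finally show ?thesis using t(1) by auto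
qed

lemma minimax_level_almost_attained:
  fixes f :: "real \<Rightarrow> 'x::topological_space \<Rightarrow> real" and \<Gamma>0 :: "((real ^ 'm) \<Rightarrow> 'x) set"
  assumes "minimax_level f \<Gamma>0 l < ereal a"
  obtains \<gamma> where "\<gamma> \<in> minimax_class \<Gamma>0" "\<And>t. t \<in> cball 0 1 \<Longrightarrow> f l (\<gamma> t) \<le> a"
proof -
  obtain \<gamma> where \<gamma>: "\<gamma> \<in> minimax_class \<Gamma>0" "(SUP t\<in>cball 0 1. ereal (f l (\<gamma> t))) < ereal a"
    using assms unfolding minimax_level_def INF_less_iff by blast
  have "ereal (f l (\<gamma> t)) \<le> ereal a" if "t \<in> cball 0 1" for t
    using SUP_upper[OF that, of "\<lambda>t. ereal (f l (\<gamma> t))"] \<gamma>(2) by (rule order_trans[OF _ less_imp_le])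
  then show thesis using that[OF \<gamma>(1)] by simp
qed

lemma boundary_value_le:
  fixes \<Gamma>0 :: "((real ^ 'm) \<Rightarrow> 'x::topological_space) set"
  assumes "p \<in> minimax_class \<Gamma>0" and \<tau>: "\<tau> \<in> sphere 0 1"
  shows "ereal (f l (p \<tau>)) \<le> boundary_level f \<Gamma>0 l"
proof -
  have "restrict p (sphere 0 1) \<in> \<Gamma>0" using assms by (simp add: minimax_class_def)
  then have "(SUP \<tau>\<in>sphere 0 1. ereal (f l (restrict p (sphere 0 1) \<tau>))) \<le> boundary_level f \<Gamma>0 l"
    unfolding boundary_level_def by (rule SUP_upper)
  moreover have "ereal (f l (restrict p (sphere 0 1) \<tau>))
      \<le> (SUP \<tau>\<in>sphere 0 1. ereal (f l (restrict p (sphere 0 1) \<tau>)))"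
    using \<tau> by (rule SUP_upper)
  ultimately show ?thesis using \<tau> by simp
qed

lemma strict_mono_less_limit:
  fixes x :: "nat \<Rightarrow> real"
  assumes "strict_mono x" "x \<longlonglongrightarrow> l"
  shows "x n < l"
proof -
  have "x n < x (Suc n)" using assms(1) by (simp add: strict_mono_Suc_iff)
  also have "\<dots> \<le> l" using strict_mono_mono[OF assms(1)] assms(2)
    by (intro incseq_le) (auto simp: incseq_def mono_def)
  finally show ?thesis .
qed

text \<open>
  This is the monotonicity trick: along a sequence on which the difference quotients of the level
  are bounded, the points relevant for the minimax problem form bounded sets.
\<close>

lemma monotonicity_trick_bounds:
  fixes f :: "real \<Rightarrow> 'x::real_normed_vector \<Rightarrow> real"
  assumes ii: "\<And>C. \<exists>M\<ge>0. \<forall>lams u lam.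
        (\<forall>h::nat. lams h \<in> \<Lambda>) \<and> strict_mono lams \<and> lams \<longlonglongrightarrow> lam \<and>
        (\<forall>h. f (lams h) (u h) \<le> C \<and> - f lam (u h) \<le> C \<and>
             (f (lams h) (u h) - f lam (u h)) / (lam - lams h) \<le> C)
        \<longrightarrow> (\<forall>h. norm (u h) \<le> M) \<and>
            (\<forall>\<epsilon>>0. \<forall>\<^sub>F h in sequentially. f lam (u h) \<le> f (lams h) (u h) + \<epsilon>)"
    and lams: "\<And>h::nat. lams h \<in> \<Lambda>" "strict_mono lams" "lams \<longlonglongrightarrow> lam"
    and T: "\<And>h. T h = {u. f (lams h) u \<le> c + K * (lam - lams h) \<and> c \<le> f lam u}"
    and ne: "\<And>h. T h \<noteq> {}"
  obtains M where "\<And>h u. u \<in> T h \<Longrightarrow> norm u \<le> M"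
    "\<And>\<delta>. 0 < \<delta> \<Longrightarrow> \<exists>h. \<forall>u\<in>T h. f lam u \<le> c + \<delta>"
proof -
  have lt: "lams h < lam" for h by (rule strict_mono_less_limit[OF lams(2,3)])
  define C where "C = \<bar>c\<bar> + \<bar>K\<bar> * (1 + (lam - lams 0))"
  have KC: "\<bar>K\<bar> \<le> C" "\<bar>c\<bar> \<le> C"
  proof -
    have "0 \<le> \<bar>K\<bar> * (lam - lams 0)" using lt[of 0] by simp
    moreover have "C = \<bar>c\<bar> + \<bar>K\<bar> + \<bar>K\<bar> * (lam - lams 0)" by (simp add: C_def distrib_left)
    ultimately show "\<bar>K\<bar> \<le> C" "\<bar>c\<bar> \<le> C" by linarith+
  qed
  have bounds: "f (lams h) u \<le> C \<and> - f lam u \<le> C \<and> (f (lams h) u - f lam u) / (lam - lams h) \<le> C"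
    if u: "u \<in> T h" for h u
  proof (intro conjI)
    have "lams 0 \<le> lams h" using strict_mono_mono[OF lams(2)] by (simp add: mono_def)
    then have "\<bar>K\<bar> * (lam - lams h) \<le> \<bar>K\<bar> * (1 + (lam - lams 0))" by (intro mult_left_mono) auto
    moreover have "K * (lam - lams h) \<le> \<bar>K\<bar> * (lam - lams h)" using lt[of h] by (intro mult_right_mono) auto
    ultimately show "f (lams h) u \<le> C" using u by (auto simp: T C_def)
    show "- f lam u \<le> C" using u KC(2) by (auto simp: T)
    have "(f (lams h) u - f lam u) / (lam - lams h) \<le> K"
      using u lt[of h] by (auto simp: T pos_divide_le_eq)
    then show "(f (lams h) u - f lam u) / (lam - lams h) \<le> C" using KC(1) by linarith
  qed
  obtain M where M: "\<And>u. (\<And>h. u h \<in> T h) \<Longrightarrow> (\<forall>h. norm (u h) \<le> M) \<and>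
      (\<forall>\<epsilon>>0. \<forall>\<^sub>F h in sequentially. f lam (u h) \<le> f (lams h) (u h) + \<epsilon>)"
  proof -
    obtain M where M: "\<forall>lams u lam.
        (\<forall>h::nat. lams h \<in> \<Lambda>) \<and> strict_mono lams \<and> lams \<longlonglongrightarrow> lam \<and>
        (\<forall>h. f (lams h) (u h) \<le> C \<and> - f lam (u h) \<le> C \<and>
             (f (lams h) (u h) - f lam (u h)) / (lam - lams h) \<le> C)
        \<longrightarrow> (\<forall>h. norm (u h) \<le> M) \<and>
            (\<forall>\<epsilon>>0. \<forall>\<^sub>F h in sequentially. f lam (u h) \<le> f (lams h) (u h) + \<epsilon>)"
      using ii[of C] by blast
    show thesis
    proof (rule that)
      fix u assume u: "\<And>h. u h \<in> T h"
      have "\<forall>h. f (lams h) (u h) \<le> C \<and> - f lam (u h) \<le> C \<and>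
          (f (lams h) (u h) - f lam (u h)) / (lam - lams h) \<le> C"
        using bounds[OF u] by blast
      then show "(\<forall>h. norm (u h) \<le> M) \<and>
          (\<forall>\<epsilon>>0. \<forall>\<^sub>F h in sequentially. f lam (u h) \<le> f (lams h) (u h) + \<epsilon>)"
        using M[rule_format, of lams lam u] lams by simp
    qed
  qed
  define w where "w h = (SOME u. u \<in> T h)" for h
  have w: "w h \<in> T h" for h using ne[of h] by (simp add: w_def some_in_eq)
  show thesis
  proof
    show "norm u \<le> M" if "u \<in> T h" for h u
    proof -
      have "(w(h := u)) k \<in> T k" for k using w that by simp
      then have "norm ((w(h := u)) h) \<le> M" using M by blast
      then show ?thesis by simp
    qed
    fix \<delta> :: real assume \<delta>: "0 < \<delta>"
    show "\<exists>h. \<forall>u\<in>T h. f lam u \<le> c + \<delta>"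
    proof (rule ccontr)
      assume "\<not> ?thesis"
      then have "\<forall>h. \<exists>u. u \<in> T h \<and> c + \<delta> < f lam u" by (auto simp: not_le)
      then obtain v where v: "\<And>h. v h \<in> T h" "\<And>h. c + \<delta> < f lam (v h)" by metis
      have "(\<lambda>h. K * (lam - lams h)) \<longlonglongrightarrow> K * (lam - lam)" by (intro tendsto_intros lams(3))
      then have "\<forall>\<^sub>F h in sequentially. K * (lam - lams h) < \<delta> / 2"
        using \<delta> by (intro order_tendstoD) auto
      moreover have "\<forall>\<^sub>F h in sequentially. f lam (v h) \<le> f (lams h) (v h) + \<delta> / 2"
        using M[OF v(1)] \<delta> by simp
      ultimately have "\<forall>\<^sub>F h in sequentially. False"
      proof eventually_elim
        case (elim h)
        then show ?case using v[of h] by (simp add: T)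
      qed
      then show False by simp
    qed
  qed
qed

lemma (in symmetrization_framework) SBPS_condition_imp_symmetric_critical_point:
  fixes g :: "'x \<Rightarrow> real"
  assumes g: "continuous_on UNIV g" and PS: "SBPS_condition j (extended_star star \<Theta>) g c"
    and almost: "\<And>e. 0 < e \<Longrightarrow> \<exists>u. norm u \<le> M \<and> \<bar>g u - c\<bar> \<le> e \<and> weak_slope g u \<le> ennreal e \<and>
        norm (j u - j (extended_star star \<Theta> u)) \<le> e"
  shows "\<exists>u. weak_slope g u = 0 \<and> g u = c \<and> u = extended_star star \<Theta> u"
proof -
  let ?st = "extended_star star \<Theta>"
  define e where "e n = 1 / real (Suc n)" for n
  have e: "0 < e n" for n by (simp add: e_def)
  have e0: "e \<longlonglongrightarrow> 0" using LIMSEQ_inverse_real_of_nat by (simp add: e_def[abs_def] inverse_eq_divide)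
  have "\<forall>n. \<exists>u. norm u \<le> M \<and> \<bar>g u - c\<bar> \<le> e n \<and> weak_slope g u \<le> ennreal (e n) \<and>
        norm (j u - j (?st u)) \<le> e n" using almost[OF e] by blast
  then obtain u where u: "\<And>n. norm (u n) \<le> M" "\<And>n. \<bar>g (u n) - c\<bar> \<le> e n"
    "\<And>n. weak_slope g (u n) \<le> ennreal (e n)" "\<And>n. norm (j (u n) - j (?st (u n))) \<le> e n" by metis
  have slope: "(\<lambda>n. weak_slope g (u n)) \<longlonglongrightarrow> 0"
  proof (rule tendsto_sandwich[OF _ _ tendsto_const])
    show "(\<lambda>n. ennreal (e n)) \<longlonglongrightarrow> 0" using tendsto_ennrealI[OF e0] by simp
  qed (use u in auto)
  have "(\<lambda>n. g (u n) - c) \<longlonglongrightarrow> 0" by (rule Lim_null_comparison[OF _ e0]) (use u in auto)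
  then have level: "(\<lambda>n. g (u n)) \<longlonglongrightarrow> c" by (simp add: LIM_zero_iff)
  have sym: "(\<lambda>n. norm (j (u n) - j (?st (u n)))) \<longlonglongrightarrow> 0"
    by (rule Lim_null_comparison[OF _ e0]) (use u in auto)
  have "bounded (range u)" using u(1) by (auto simp: bounded_iff)
  then have "SBPS_sequence j ?st g c u" using slope level sym by (simp add: SBPS_sequence_def)
  then obtain r x where r: "strict_mono r" "(u \<circ> r) \<longlonglongrightarrow> x"
    using PS by (auto simp: SBPS_condition_def convergent_def)
  have "weak_slope g x = 0"
    by (rule weak_slope_eq_0_limit[OF r(2)])
       (use LIMSEQ_subseq_LIMSEQ[OF slope r(1)] in \<open>simp add: o_def\<close>)
  moreover have "g x = c"
  proof (rule LIMSEQ_unique)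
    show "(\<lambda>n. g ((u \<circ> r) n)) \<longlonglongrightarrow> g x" by (rule continuous_on_tendsto_compose[OF g r(2)]) auto
    show "(\<lambda>n. g ((u \<circ> r) n)) \<longlonglongrightarrow> c" using LIMSEQ_subseq_LIMSEQ[OF level r(1)] by (simp add: o_def)
  qed
  moreover have "x = ?st x"
  proof -
    obtain L where L: "0 \<le> L" "\<And>u v. norm (j (?st u) - j (?st v)) \<le> L * norm (j u - j v)"
      using extended_star_lipschitz by blast
    have jx: "(\<lambda>n. j ((u \<circ> r) n)) \<longlonglongrightarrow> j x"
      by (rule bounded_linear.tendsto[OF embedding_bounded_linear r(2)])
    have "(\<lambda>n. L * norm (j ((u \<circ> r) n) - j x)) \<longlonglongrightarrow> L * norm (j x - j x)"
      by (intro tendsto_intros jx)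
    then have lim: "(\<lambda>n. L * norm (j ((u \<circ> r) n) - j x)) \<longlonglongrightarrow> 0" by simp
    have "(\<lambda>n. j (?st ((u \<circ> r) n)) - j (?st x)) \<longlonglongrightarrow> 0"
      by (rule Lim_null_comparison[OF always_eventually lim]) (use L(2) in blast)
    then have "(\<lambda>n. j (?st ((u \<circ> r) n))) \<longlonglongrightarrow> j (?st x)" by (simp add: LIM_zero_iff)
    then have "(\<lambda>n. norm (j ((u \<circ> r) n) - j (?st ((u \<circ> r) n)))) \<longlonglongrightarrow> norm (j x - j (?st x))"
      by (intro tendsto_intros jx)
    moreover have "(\<lambda>n. norm (j ((u \<circ> r) n) - j (?st ((u \<circ> r) n)))) \<longlonglongrightarrow> 0"
      using LIMSEQ_subseq_LIMSEQ[OF sym r(1)] by (simp add: o_def)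
    ultimately have "norm (j x - j (?st x)) = 0" using LIMSEQ_unique by blast
    then show ?thesis using embedding_inj by (simp add: inj_eq)
  qed
  ultimately show ?thesis by blast
qed

theorem corollary3p2:
  fixes j :: "'x::banach \<Rightarrow> 'v::banach"
    and S :: "'x set"
    and star :: "'x \<Rightarrow> 'x"
    and pol :: "'x \<Rightarrow> 'h::topological_space \<Rightarrow> 'x"
    and \<Theta> :: "'x \<Rightarrow> 'x"
    and \<Lambda> :: "real set"
    and f :: "real \<Rightarrow> 'x \<Rightarrow> real"
    and \<Gamma>0 :: "((real ^ 'm) \<Rightarrow> 'x) set"
  assumes framework: "symmetrization_framework j S star pol \<Theta>"
    and \<Lambda>: "is_interval \<Lambda>" "compact \<Lambda>"
    and f_cont: "\<And>lam. lam \<in> \<Lambda> \<Longrightarrow> continuous_on UNIV (f lam)"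
    and \<Gamma>0: "\<Gamma>0 \<subseteq> continuous_maps (sphere 0 1)"
    and \<Gamma>_nonempty: "minimax_class \<Gamma>0 \<noteq> {}"
    and i: "\<And>lam. lam \<in> \<Lambda> \<Longrightarrow> minimax_level f \<Gamma>0 lam > boundary_level f \<Gamma>0 lam"
    and ii: "\<And>C. \<exists>M\<ge>0. \<forall>lams u lam.
        (\<forall>h::nat. lams h \<in> \<Lambda>) \<and> strict_mono lams \<and> lams \<longlonglongrightarrow> lam \<and>
        (\<forall>h. f (lams h) (u h) \<le> C \<and> - f lam (u h) \<le> C \<and>
             (f (lams h) (u h) - f lam (u h)) / (lam - lams h) \<le> C)
        \<longrightarrow> (\<forall>h. norm (u h) \<le> M) \<and>
            (\<forall>\<epsilon>>0. \<forall>\<^sub>F h in sequentially. f lam (u h) \<le> f (lams h) (u h) + \<epsilon>)"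
    and iii_path: "\<And>\<gamma>. \<gamma> \<in> minimax_class \<Gamma>0 \<Longrightarrow>
        \<exists>\<gamma>'\<in>minimax_class \<Gamma>0. \<exists>H0.
          \<gamma>' ` cball 0 1 \<subseteq> S \<and>
          (\<lambda>\<tau>\<in>sphere 0 1. pol (\<gamma>' \<tau>) H0) \<in> \<Gamma>0 \<and>
          (\<forall>t\<in>cball 0 1. \<forall>lam\<in>\<Lambda>. f lam (\<gamma>' t) \<le> f lam (\<gamma> t))"
    and iii_pol: "\<And>lam H u. lam \<in> \<Lambda> \<Longrightarrow> u \<in> S \<Longrightarrow> f lam (pol u H) \<le> f lam u"
  shows "AE lam in lebesgue. lam \<in> \<Lambda> \<longrightarrow>
      SBPS_condition j (extended_star star \<Theta>) (f lam) (real_of_ereal (minimax_level f \<Gamma>0 lam)) \<longrightarrow>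
      (\<exists>u. weak_slope (f lam) u = 0 \<and>
           ereal (f lam u) = minimax_level f \<Gamma>0 lam \<and>
           u = extended_star star \<Theta> u)"
proof -
  interpret symmetrization_framework j S star pol \<Theta> by (rule framework)
  let ?st = "extended_star star \<Theta>"
  define cc where "cc l = real_of_ereal (minimax_level f \<Gamma>0 l)" for l
  have cc: "minimax_level f \<Gamma>0 l = ereal (cc l)" if "l \<in> \<Lambda>" for l
    using minimax_level_finite[where f = f and lam = l, OF \<Gamma>_nonempty f_cont[OF that] i[OF that]]
    by (simp add: cc_def)
  obtain L where L: "0 \<le> L" "\<And>u v. norm (j (?st u) - j (?st v)) \<le> L * norm (j u - j v)"
    using extended_star_lipschitz by blast
  obtain J where J: "0 < J" "\<And>x. norm (j x) \<le> norm x * J"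
    using bounded_linear.pos_bounded[OF embedding_bounded_linear] by blast
  have "\<exists>u. weak_slope (f lam) u = 0 \<and> ereal (f lam u) = minimax_level f \<Gamma>0 lam \<and> u = ?st u"
    if lam: "lam \<in> \<Lambda>" and PS: "SBPS_condition j ?st (f lam) (cc lam)"
      and lams: "\<And>h::nat. lams h \<in> \<Lambda>" "strict_mono lams" "lams \<longlonglongrightarrow> lam"
      and K: "\<And>h. cc (lams h) - cc lam \<le> K * (lam - lams h)" for lam lams K
  proof -
    define c where "c = cc lam"
    define a where "a h = c + (K + 1) * (lam - lams h)" for h
    have lt: "lams h < lam" for h by (rule strict_mono_less_limit[OF lams(2,3)])
    have "minimax_level f \<Gamma>0 (lams h) < ereal (a h)" for h
      using K[of h] lt[of h] by (simp add: cc[OF lams(1)] a_def c_def algebra_simps)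
    then have almost_min: "\<exists>\<gamma>\<in>minimax_class \<Gamma>0. \<forall>t\<in>cball 0 1. f (lams h) (\<gamma> t) \<le> a h" for h
      by (rule minimax_level_almost_attained) blast
    have level: "\<exists>t\<in>cball 0 1. c \<le> f lam (p t)" if "p \<in> minimax_class \<Gamma>0" for p
      unfolding c_def by (rule minimax_level_le_value[where f = f, OF f_cont[OF lam] that cc[OF lam]])
    define T where "T h = {u. f (lams h) u \<le> a h \<and> c \<le> f lam u}" for h
    have "T h \<noteq> {}" for h
    proof -
      obtain \<gamma> where \<gamma>: "\<gamma> \<in> minimax_class \<Gamma>0" "\<forall>t\<in>cball 0 1. f (lams h) (\<gamma> t) \<le> a h"
        using almost_min by blast
      obtain t where "t \<in> cball 0 1" "c \<le> f lam (\<gamma> t)" using level[OF \<gamma>(1)] by blast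
      then have "\<gamma> t \<in> T h" using \<gamma>(2) by (simp add: T_def)
      then show ?thesis by blast
    qed
    moreover have "T h = {u. f (lams h) u \<le> c + (K + 1) * (lam - lams h) \<and> c \<le> f lam u}" for h
      by (simp add: T_def a_def)
    ultimately obtain M where M: "\<And>h u. u \<in> T h \<Longrightarrow> norm u \<le> M"
      "\<And>\<delta>. 0 < \<delta> \<Longrightarrow> \<exists>h. \<forall>u\<in>T h. f lam u \<le> c + \<delta>"
      using monotonicity_trick_bounds[of \<Lambda> f lams lam T c "K + 1", OF ii lams] by blast
    have "boundary_level f \<Gamma>0 lam < ereal c" using i[OF lam] by (simp add: cc[OF lam] c_def)
    then obtain b where b: "boundary_level f \<Gamma>0 lam < ereal b" "b < c"
      using ereal_dense2 by fastforce
    have boundary: "f lam (p \<tau>) < b" if "p \<in> minimax_class \<Gamma>0" "\<tau> \<in> sphere 0 1" for p \<tau>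
      using le_less_trans[OF boundary_value_le[of p \<Gamma>0 \<tau> f lam, OF that] b(1)] by simp
    have "\<exists>u. norm u \<le> M + 1 \<and> \<bar>f lam u - c\<bar> \<le> e \<and> weak_slope (f lam) u \<le> ennreal e \<and>
        norm (j u - j (?st u)) \<le> e" if e: "0 < e" for e
    proof -
      define r where "r = min 1 (e / (2 * ((1 + L) * J)))"
      have pos: "0 < (1 + L) * J" using L(1) J(1) by simp
      have r: "0 < r" "r \<le> 1" using e pos by (auto simp: r_def)
      have "r \<le> e / (2 * ((1 + L) * J))" by (simp add: r_def)
      then have rJ: "(1 + L) * J * r \<le> e / 2" using pos by (simp add: pos_le_divide_eq field_simps)
      have er: "0 < e * r" "e * r \<le> e" using e r by (auto simp: mult_le_cancel_left1)
      obtain h where h: "\<forall>u\<in>T h. f lam u \<le> c + e * r" using M(2)[OF er(1)] by blast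
      obtain \<gamma>0 where \<gamma>0: "\<gamma>0 \<in> minimax_class \<Gamma>0" "\<And>t. t \<in> cball 0 1 \<Longrightarrow> f (lams h) (\<gamma>0 t) \<le> a h"
        using almost_min by blast
      obtain \<gamma> H0 where \<gamma>: "\<gamma> \<in> minimax_class \<Gamma>0" "\<gamma> ` cball 0 1 \<subseteq> S"
        "(\<lambda>\<tau>\<in>sphere 0 1. pol (\<gamma> \<tau>) H0) \<in> \<Gamma>0"
        "\<And>t. t \<in> cball 0 1 \<Longrightarrow> f (lams h) (\<gamma> t) \<le> f (lams h) (\<gamma>0 t)"
        using iii_path[OF \<gamma>0(1)] lams(1)[of h] by blast
      have below: "f (lams h) (\<gamma> t) \<le> a h" if "t \<in> cball 0 1" for t
        using \<gamma>(4)[OF that] \<gamma>0(2)[OF that] by simp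
      have control: "norm v \<le> M \<and> f lam v \<le> c + e * r" if "f (lams h) v \<le> a h" "c \<le> f lam v" for v
        using M(1)[of v h] h that by (auto simp: T_def)
      have e2: "0 < e / 2" using e by simp
      obtain u v where uv: "dist u v \<le> r" "v \<in> S" "norm v \<le> M" "norm (j v - j (star v)) < e / 2"
        "c \<le> f lam u" "f lam u \<le> c + e * r" "weak_slope (f lam) u \<le> ennreal e"
      proof (rule almost_symmetric_almost_critical_point[of "f lam" \<Gamma>0 c b "f (lams h)" \<gamma> H0 "a h" e r
              "e / 2" M])
        show "\<exists>t\<in>cball 0 1. c \<le> f lam (p t)" if "p \<in> minimax_class \<Gamma>0" for p
          using that by (rule level)
        show "f lam (p \<tau>) < b" if "p \<in> minimax_class \<Gamma>0" "\<tau> \<in> sphere 0 1" for p \<tau>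
          using that by (rule boundary)
      qed ((rule f_cont[OF lam] b(2) \<gamma>(1-3) e r(1) e2 iii_pol[OF lam] iii_pol[OF lams(1)] below control;
            assumption?) | blast)+
      have st: "?st v = star v" using Theta_id[OF uv(2)] by (simp add: extended_star_def)
      have juv: "norm (j u - j v) \<le> J * r"
      proof -
        have "norm (j u - j v) = norm (j (u - v))"
          using embedding_bounded_linear by (simp add: linear_diff bounded_linear.linear)
        also have "\<dots> \<le> norm (u - v) * J" by (rule J(2))
        also have "\<dots> \<le> r * J" using uv(1) J(1) by (intro mult_right_mono) (auto simp: dist_norm)
        finally show ?thesis by (simp add: mult.commute)
      qed
      have "norm (j u - j (?st u)) = norm ((j u - j v) + (j v - j (star v)) + (j (?st v) - j (?st u)))"
        by (simp add: st)
      also have "\<dots> \<le> norm (j u - j v) + norm (j v - j (star v)) + L * norm (j u - j v)"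
        using L(2)[of v u] by (intro norm_triangle_mono) (auto simp: norm_minus_commute)
      also have "\<dots> = (1 + L) * norm (j u - j v) + norm (j v - j (star v))" by (simp add: algebra_simps)
      also have "\<dots> \<le> (1 + L) * (J * r) + e / 2"
        using juv L(1) uv(4) by (intro add_mono mult_left_mono) auto
      also have "\<dots> \<le> e" using rJ by (simp add: mult.assoc)
      finally have "norm (j u - j (?st u)) \<le> e" .
      moreover have "norm u \<le> M + 1"
        using norm_triangle_sub[of u v] uv(1,3) r(2) by (simp add: dist_norm)
      moreover have "\<bar>f lam u - c\<bar> \<le> e" using uv(5,6) er(2) by auto
      ultimately show ?thesis using uv(7) by blast
    qed
    then have "\<exists>u. weak_slope (f lam) u = 0 \<and> f lam u = c \<and> u = ?st u"
      by (rule SBPS_condition_imp_symmetric_critical_point[OF f_cont[OF lam] PS[folded c_def]])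
    then show ?thesis by (simp add: cc[OF lam] c_def)
  qed
  note critical = this
  show ?thesis
    using AE_left_sequence_bounded_slope[of \<Lambda> cc]
  proof eventually_elim
    case (elim lam)
    then show ?case using critical[of lam] unfolding cc_def by blast
  qed
qed

end
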